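(* Let $p,q$ be odd positive integers, $m=p+q$, and let $k,\ell\ge 0$ be integers. Let $w(\overline z)=u(x,y)+iv(x,y)$ (with $u,v$ real-valued) be an antiholomorphic function in the open set $\Xi\subset\{(x,y)\in\mathbb R^2:\ x,y>0\}$. Suppose that $H_k(\underline x):\mathbb R^{p}\rightarrow\mathbb{R}_{p}$ and $H_\ell(\underline y):\mathbb R^{q}\rightarrow\mathbb{R}_{q}$ are homogeneous polynomials of degrees $k$ and $\ell$ respectively. Then the functions $$\Delta_{\underline X}^{k+\ell+\frac{m-2}{2}}\left[\left(u(\vert\underline x\vert,\vert\underline y\vert)+\frac{\underline x\,\underline y}{\vert\underline x\vert\vert\underline y\vert}\,v(\vert\underline x\vert,\vert\underline y\vert)\right)H_k(\underline x)H_\ell(\underline y)\right]$$ and $$\Delta_{\underline X}^{k+\ell+\frac{m-2}{2}}\left[\left(\frac{\underline x}{\vert\underline x\vert}\,u(\vert\underline x\vert,\vert\underline y\vert)+\frac{\underline y}{\vert\underline y\vert}\,v(\vert\underline x\vert,\vert\underline y\vert)\right)H_k(\underline x)H_\ell(\underline y)\right]$$ are monogenic in $\Omega=\{\underline X=(\underline x,\underline y)\in\mathbb R^{m}:\ (\vert\underline x\vert,\vert\underline y\vert)\in\Xi\}$.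
   Context: $\mathbb R_m$ denotes the real Clifford algebra generated by the standard basis $e_1,\dots,e_m$ of $\mathbb R^m$, with relations $e_j^2=-1$ and $e_je_k+e_ke_j=0$ for $1\le j\ne k\le m$; it has real dimension $2^m$. Write $\mathbb R^m=\mathbb R^p\oplus\mathbb R^q$ with $p+q=m$; $\mathbb R_p$ and $\mathbb R_q$ denote the subalgebras of $\mathbb R_m$ generated by $\{e_1,\dots,e_p\}$ and $\{e_{p+1},\dots,e_m\}$ respectively. A point of $\mathbb R^m$ is identified with the Clifford vector $\underline X=\underline x+\underline y$, where $\underline x=\sum_{j=1}^p x_je_j$ and $\underline y=\sum_{j=1}^q x_{p+j}e_{p+j}$; $\vert\cdot\vert$ is the Euclidean norm. All products are Clifford products in the order written. The Dirac operator in $\mathbb R^m$ is $\partial_{\underline X}=\sum_{j=1}^m e_j\partial_{x_j}$ (with $e_j$ multiplying from the left), and $\Delta_{\underline X}=\sum_{j=1}^m\partial_{x_j}^2$ is the Laplacian. A continuously differentiable function $F:\Omega\to\mathbb R_m$ on an open set $\Omega\subset\mathbb R^m$ is called (left) monogenic in $\Omega$ if $\partial_{\underline X}F=0$ in $\Omega$. A function $w=u+iv$ of $z=x+iy$ is antiholomorphic if $\partial_z w=0$, where $\partial_z=\frac12(\partial_x-i\partial_y)$. Polynomials with values in a Clifford algebra are polynomials in the real coordinates with coefficients in that algebra. *)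

theory Defs
  imports "HOL-Analysis.Analysis"
begin

text \<open>
  The coordinates of \<open>\<real>\<^sup>m = \<real>\<^sup>p \<oplus> \<real>\<^sup>q\<close> are indexed by the sum type \<^typ>\<open>'p + 'q\<close>. The left summand
  (the indices \<open>1, \<dots>, p\<close>) precedes the right one (the indices \<open>p + 1, \<dots>, m\<close>).
\<close>

instantiation sum :: (linorder, linorder) linorder
begin

fun less_eq_sum :: "'a + 'b \<Rightarrow> 'a + 'b \<Rightarrow> bool" where
  "less_eq_sum (Inl a) (Inl b) \<longleftrightarrow> a \<le> b"
| "less_eq_sum (Inl a) (Inr b) \<longleftrightarrow> True"
| "less_eq_sum (Inr a) (Inl b) \<longleftrightarrow> False"
| "less_eq_sum (Inr a) (Inr b) \<longleftrightarrow> a \<le> b"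

definition less_sum :: "'a + 'b \<Rightarrow> 'a + 'b \<Rightarrow> bool" where
  "less_sum x y \<longleftrightarrow> x \<le> y \<and> \<not> y \<le> x"

instance
proof
  fix x y z :: "'a + 'b"
  show "x < y \<longleftrightarrow> x \<le> y \<and> \<not> y \<le> x" by (rule less_sum_def)
  show "x \<le> x" by (cases x) auto
  show "x \<le> y \<Longrightarrow> y \<le> z \<Longrightarrow> x \<le> z" by (cases x; cases y; cases z) auto
  show "x \<le> y \<Longrightarrow> y \<le> x \<Longrightarrow> x = y" by (cases x; cases y) auto
  show "x \<le> y \<or> y \<le> x" by (cases x; cases y) auto
qed

end

text \<open>
  An element is given by its coefficients with respect to the basis of blades \<open>e\<^sub>A\<close>, where \<open>A\<close> runs
  over the sets of indices and \<open>e\<^sub>A\<close> is the product of the generators \<open>e\<^sub>j\<close>, \<open>j \<in> A\<close>, in increasing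
  order.
\<close>

typedef 'n clifford = "UNIV :: (real ^ ('n::finite) set) set"
  morphisms coeffs Clifford ..

setup_lifting type_definition_clifford

lemma clifford_eq_iff: "x = y \<longleftrightarrow> (\<forall>A. coeffs x $ A = coeffs y $ A)"
  by (simp add: coeffs_inject [symmetric] vec_eq_iff)

instantiation clifford :: (finite) euclidean_space
begin

lift_definition zero_clifford :: "'a clifford" is 0 .
lift_definition plus_clifford :: "'a clifford \<Rightarrow> 'a clifford \<Rightarrow> 'a clifford" is "(+)" .
lift_definition minus_clifford :: "'a clifford \<Rightarrow> 'a clifford \<Rightarrow> 'a clifford" is "(-)" .
lift_definition uminus_clifford :: "'a clifford \<Rightarrow> 'a clifford" is uminus .
lift_definition scaleR_clifford :: "real \<Rightarrow> 'a clifford \<Rightarrow> 'a clifford" is scaleR .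
lift_definition inner_clifford :: "'a clifford \<Rightarrow> 'a clifford \<Rightarrow> real" is inner .
lift_definition norm_clifford :: "'a clifford \<Rightarrow> real" is norm .
lift_definition Basis_clifford :: "'a clifford set" is Basis .

definition sgn_clifford :: "'a clifford \<Rightarrow> 'a clifford" where
  "sgn_clifford x = inverse (norm x) *\<^sub>R x"

definition dist_clifford :: "'a clifford \<Rightarrow> 'a clifford \<Rightarrow> real" where
  "dist_clifford x y = norm (x - y)"

definition uniformity_clifford :: "('a clifford \<times> 'a clifford) filter" where
  "uniformity_clifford = (INF e\<in>{0<..}. principal {(x, y). dist x y < e})"

definition open_clifford :: "'a clifford set \<Rightarrow> bool" where
  "open_clifford U \<longleftrightarrow> (\<forall>x\<in>U. \<forall>\<^sub>F (x', y) in uniformity. x' = x \<longrightarrow> y \<in> U)"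

instance
proof
  fix x y z :: "'a clifford" and a b :: real and U :: "'a clifford set"
  show "x + y + z = x + (y + z)" by transfer (rule add.assoc)
  show "x + y = y + x" by transfer (rule add.commute)
  show "0 + x = x" by transfer simp
  show "- x + x = 0" by transfer simp
  show "x - y = x + - y" by transfer simp
  show "a *\<^sub>R (x + y) = a *\<^sub>R x + a *\<^sub>R y" by transfer (rule scaleR_add_right)
  show "(a + b) *\<^sub>R x = a *\<^sub>R x + b *\<^sub>R x" by transfer (rule scaleR_add_left)
  show "a *\<^sub>R b *\<^sub>R x = (a * b) *\<^sub>R x" by transfer simp
  show "1 *\<^sub>R x = x" by transfer simp
  show "sgn x = inverse (norm x) *\<^sub>R x" by (rule sgn_clifford_def)
  show "dist x y = norm (x - y)" by (rule dist_clifford_def)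
  show "(uniformity :: ('a clifford \<times> 'a clifford) filter)
      = (INF e\<in>{0<..}. principal {(x, y). dist x y < e})"
    by (rule uniformity_clifford_def)
  show "open U \<longleftrightarrow> (\<forall>x\<in>U. \<forall>\<^sub>F (x', y) in uniformity. x' = x \<longrightarrow> y \<in> U)"
    by (rule open_clifford_def)
  show "inner x y = inner y x" by transfer (rule inner_commute)
  show "inner (x + y) z = inner x z + inner y z" by transfer (rule inner_add_left)
  show "inner (a *\<^sub>R x) y = a * inner x y" by transfer simp
  show "0 \<le> inner x x" by transfer simp
  show "inner x x = 0 \<longleftrightarrow> x = 0" by transfer simp
  show "norm x = sqrt (inner x x)" by transfer (rule norm_eq_sqrt_inner)
  show "(Basis :: 'a clifford set) \<noteq> {}" by transfer simp
  show "finite (Basis :: 'a clifford set)" by transfer simp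
  show "x \<in> Basis \<Longrightarrow> y \<in> Basis \<Longrightarrow> inner x y = (if x = y then 1 else 0)"
    by transfer (simp add: inner_Basis)
  show "(\<forall>u\<in>Basis. inner x u = 0) \<longleftrightarrow> x = 0"
    by transfer (rule euclidean_all_zero_iff)
qed

end

lemma coeffs_linear [simp]:
  "coeffs 0 = 0" "coeffs (x + y) = coeffs x + coeffs y" "coeffs (x - y) = coeffs x - coeffs y"
  "coeffs (- x) = - coeffs x" "coeffs (a *\<^sub>R x) = a *\<^sub>R coeffs x"
  by (transfer; simp)+

text \<open>
  Sorting the word \<open>e\<^sub>A e\<^sub>B\<close> by means of \<open>e\<^sub>j e\<^sub>k = - e\<^sub>k e\<^sub>j\<close> contributes a factor \<open>-1\<close> for each pair
  \<open>(a, b) \<in> A \<times> B\<close> with \<open>b < a\<close>; cancelling the squares \<open>e\<^sub>j\<^sup>2 = -1\<close> contributes a factor \<open>-1\<close> for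
  each pair with \<open>b = a\<close>. Hence \<open>e\<^sub>A e\<^sub>B = blade_sign A B \<cdot> e\<^sub>C\<close>, where \<open>C\<close> is the symmetric difference
  of \<open>A\<close> and \<open>B\<close>.
\<close>

definition blade_sign :: "('n::{finite,linorder}) set \<Rightarrow> 'n set \<Rightarrow> real" where
  "blade_sign A B = (\<Prod>a\<in>A. \<Prod>b\<in>B. if b \<le> a then -1 else 1)"

lemma blade_sign_empty [simp]: "blade_sign {} B = 1" "blade_sign A {} = 1"
  by (simp_all add: blade_sign_def)

lemma prod_sym_diff:
  fixes f :: "'n::finite \<Rightarrow> real"
  assumes "\<And>a. f a * f a = 1"
  shows "prod f (sym_diff A B) = prod f A * prod f B"
proof -
  have A: "prod f A = prod f (A - B) * prod f (A \<inter> B)"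
    by (subst prod.union_disjoint [symmetric]) (auto intro!: prod.cong)
  have B: "prod f B = prod f (B - A) * prod f (A \<inter> B)"
    by (subst prod.union_disjoint [symmetric]) (auto intro!: prod.cong)
  have "prod f (A \<inter> B) * prod f (A \<inter> B) = 1"
    by (simp add: prod.distrib [symmetric] assms)
  then have "prod f A * prod f B = prod f (A - B) * prod f (B - A)"
    unfolding A B by (simp add: mult.assoc mult.left_commute)
  also have "\<dots> = prod f (sym_diff A B)"
    by (subst prod.union_disjoint) auto
  finally show ?thesis ..
qed

lemma blade_sign_sym_diff_left:
  "blade_sign (sym_diff A B) C = blade_sign A C * blade_sign B C"
  unfolding blade_sign_def
  by (rule prod_sym_diff) (simp add: prod.distrib [symmetric] if_distrib cong: if_cong)

lemma blade_sign_sym_diff_right: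
  "blade_sign A (sym_diff B C) = blade_sign A B * blade_sign A C"
  unfolding blade_sign_def prod.distrib [symmetric]
  by (intro prod.cong refl prod_sym_diff) simp

lemma bij_sym_diff: "bij (\<lambda>B. sym_diff A B)"
  by (rule o_bij [where g = "\<lambda>B. sym_diff A B"]) (auto simp: fun_eq_iff)

instantiation clifford :: ("{finite,linorder}") real_algebra_1
begin

lift_definition one_clifford :: "'a clifford" is "axis {} 1" .

text \<open>Every blade \<open>e\<^sub>C\<close> is, up to sign, the product of \<open>e\<^sub>A\<close> and \<open>e\<^sub>B\<close> with \<open>B\<close> the symmetric
  difference of \<open>A\<close> and \<open>C\<close>.\<close>

lift_definition times_clifford :: "'a clifford \<Rightarrow> 'a clifford \<Rightarrow> 'a clifford" is
  "\<lambda>x y. \<chi> C. \<Sum>A\<in>UNIV. blade_sign A (sym_diff A C) * x $ A * y $ sym_diff A C" .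

instance
proof
  fix x y z :: "'a clifford" and a :: real
  show "x * y * z = x * (y * z)"
  proof (transfer, subst vec_eq_iff, intro allI)
    fix x y z :: "real ^ 'a set" and D :: "'a set"
    let ?s = "blade_sign :: 'a set \<Rightarrow> 'a set \<Rightarrow> real"
    have sd: "sym_diff (sym_diff A B) D = sym_diff B (sym_diff A D)"
      "sym_diff A (sym_diff A B) = B" for A B :: "'a set"
      by auto
    have "(\<Sum>C\<in>UNIV. ?s C (sym_diff C D)
          * (\<Sum>A\<in>UNIV. ?s A (sym_diff A C) * x $ A * y $ sym_diff A C) * z $ sym_diff C D)
        = (\<Sum>A\<in>UNIV. \<Sum>C\<in>UNIV. ?s C (sym_diff C D) * ?s A (sym_diff A C)
          * x $ A * y $ sym_diff A C * z $ sym_diff C D)"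
      unfolding sum_distrib_left sum_distrib_right
      by (subst sum.swap) (simp add: mult_ac)
    also have "\<dots> = (\<Sum>A\<in>UNIV. \<Sum>B\<in>UNIV. ?s (sym_diff A B) (sym_diff (sym_diff A B) D)
          * ?s A (sym_diff A (sym_diff A B))
          * x $ A * y $ sym_diff A (sym_diff A B) * z $ sym_diff (sym_diff A B) D)"
      by (intro sum.cong refl sum.reindex_bij_betw [symmetric] bij_sym_diff)
    also have "\<dots> = (\<Sum>A\<in>UNIV. \<Sum>B\<in>UNIV. ?s A (sym_diff A D) * x $ A
          * (?s B (sym_diff B (sym_diff A D)) * y $ B * z $ sym_diff B (sym_diff A D)))"
    proof (intro sum.cong refl)
      fix A B :: "'a set"
      have *: "?s A B * ?s A B = 1"
        unfolding blade_sign_def prod.distrib [symmetric] by (intro prod.neutral ballI) simp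
      have "?s (sym_diff A B) (sym_diff B (sym_diff A D)) * ?s A B
          = ?s A (sym_diff A D) * ?s B (sym_diff B (sym_diff A D)) * (?s A B * ?s A B)"
        by (subst blade_sign_sym_diff_left, subst blade_sign_sym_diff_right [of A B])
          (simp add: mult_ac)
      then show "?s (sym_diff A B) (sym_diff (sym_diff A B) D)
            * ?s A (sym_diff A (sym_diff A B))
            * x $ A * y $ sym_diff A (sym_diff A B) * z $ sym_diff (sym_diff A B) D
          = ?s A (sym_diff A D) * x $ A
            * (?s B (sym_diff B (sym_diff A D)) * y $ B * z $ sym_diff B (sym_diff A D))"
        unfolding sd * by (simp only: mult_1_right mult_ac)
    qed
    finally show "(\<chi> C. \<Sum>A\<in>UNIV. ?s A (sym_diff A C)
          * (\<chi> C. \<Sum>A\<in>UNIV. ?s A (sym_diff A C) * x $ A * y $ sym_diff A C) $ A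
          * z $ sym_diff A C) $ D
        = (\<chi> C. \<Sum>A\<in>UNIV. ?s A (sym_diff A C) * x $ A
          * (\<chi> C. \<Sum>A\<in>UNIV. ?s A (sym_diff A C) * y $ A * z $ sym_diff A C) $ sym_diff A C) $ D"
      by (simp add: sum_distrib_left)
  qed
  show "(x + y) * z = x * z + y * z"
    by transfer (simp add: vec_eq_iff algebra_simps sum.distrib)
  show "x * (y + z) = x * y + x * z"
    by transfer (simp add: vec_eq_iff algebra_simps sum.distrib)
  show "a *\<^sub>R x * y = a *\<^sub>R (x * y)"
    by transfer (simp add: vec_eq_iff sum_distrib_left mult_ac)
  show "x * a *\<^sub>R y = a *\<^sub>R (x * y)"
    by transfer (simp add: vec_eq_iff sum_distrib_left mult_ac)
  show "1 * x = x"
  proof (transfer, subst vec_eq_iff, intro allI)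
    fix x :: "real ^ 'a set" and C :: "'a set"
    have "(\<Sum>A\<in>UNIV. blade_sign A (sym_diff A C) * axis {} 1 $ A * x $ sym_diff A C)
        = (\<Sum>A\<in>(UNIV :: 'a set set). if A = {} then x $ C else 0)"
      by (intro sum.cong refl) (simp add: axis_def)
    then show "(\<chi> C. \<Sum>A\<in>UNIV. blade_sign A (sym_diff A C) * axis {} 1 $ A
        * x $ sym_diff A C) $ C = x $ C"
      by simp
  qed
  show "x * 1 = x"
  proof (transfer, subst vec_eq_iff, intro allI)
    fix x :: "real ^ 'a set" and C :: "'a set"
    have "sym_diff A C = {} \<longleftrightarrow> A = C" for A
      by auto
    then have "(\<Sum>A\<in>UNIV. blade_sign A (sym_diff A C) * x $ A * axis {} 1 $ sym_diff A C)
        = (\<Sum>A\<in>UNIV. if A = C then x $ C else 0)"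
      by (intro sum.cong refl) (simp add: axis_def)
    then show "(\<chi> C. \<Sum>A\<in>UNIV. blade_sign A (sym_diff A C) * x $ A
        * axis {} 1 $ sym_diff A C) $ C = x $ C"
      by simp
  qed
  show "(0 :: 'a clifford) \<noteq> 1"
    by transfer (simp add: axis_eq_0_iff)
qed

end

lift_definition blade :: "'n::finite set \<Rightarrow> 'n clifford" is "\<lambda>A. axis A 1" .

definition gen :: "'n::finite \<Rightarrow> 'n clifford" where
  "gen j = blade {j}"

lemma blade_empty: "blade {} = 1"
  by transfer simp

lemma blade_mult: "blade A * blade B = blade_sign A B *\<^sub>R blade (sym_diff A B)"
proof (transfer, subst vec_eq_iff, intro allI)
  fix A B C :: "'n::{finite,linorder} set"
  have *: "A' = A \<and> sym_diff A' C = B \<longleftrightarrow> A' = A \<and> C = sym_diff A B" for A' :: "'n set"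
    by auto
  have "(\<Sum>A'\<in>UNIV. blade_sign A' (sym_diff A' C) * axis A 1 $ A' * axis B 1 $ sym_diff A' C)
      = (\<Sum>A'\<in>UNIV. if A' = A then (if C = sym_diff A B then blade_sign A B else 0) else 0)"
    by (intro sum.cong refl) (use * in \<open>auto simp: axis_def\<close>)
  then show "(\<chi> C. \<Sum>A'\<in>UNIV. blade_sign A' (sym_diff A' C) * axis A 1 $ A'
        * axis B 1 $ sym_diff A' C) $ C
      = (blade_sign A B *\<^sub>R axis (sym_diff A B) 1) $ C"
    by (simp add: axis_def)
qed

lemma blade_insert:
  assumes "\<And>a. a \<in> A \<Longrightarrow> j < a"
  shows "blade (insert j A) = gen j * blade A"
proof -
  have "blade_sign {j} A = 1"
    unfolding blade_sign_def using assms by (auto intro!: prod.neutral simp: not_le [symmetric])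
  moreover have "sym_diff {j} A = insert j A"
    using assms by auto
  ultimately show ?thesis
    by (simp add: gen_def blade_mult del: Un_insert_left Un_insert_right)
qed

lemma gen_square: "gen j * gen j = -1"
  by (simp add: gen_def blade_mult blade_sign_def blade_empty)

lemma gen_anticommute:
  assumes "j \<noteq> k"
  shows "gen j * gen k + gen k * gen j = 0"
proof -
  have "sym_diff {j} {k} = sym_diff {k} {j}"
    by auto
  then show ?thesis
    using assms by (auto simp: gen_def blade_mult blade_sign_def scaleR_left_distrib [symmetric]
        simp del: Un_insert_left Un_insert_right)
qed

lemma DIM_clifford: "DIM('n::finite clifford) = 2 ^ CARD('n)"
proof -
  have "DIM('n clifford) = DIM(real ^ 'n set)"
    unfolding Basis_clifford_def
    by (rule card_image) (auto simp: inj_on_def Clifford_inject)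
  then show ?thesis
    by (simp add: card_Pow flip: Pow_UNIV)
qed

inductive_set subalgebra_generated :: "'a::real_algebra_1 set \<Rightarrow> 'a set"
  for G :: "'a set" where
  one: "1 \<in> subalgebra_generated G"
| gen: "x \<in> G \<Longrightarrow> x \<in> subalgebra_generated G"
| add: "x \<in> subalgebra_generated G \<Longrightarrow> y \<in> subalgebra_generated G \<Longrightarrow>
    x + y \<in> subalgebra_generated G"
| scaleR: "x \<in> subalgebra_generated G \<Longrightarrow> a *\<^sub>R x \<in> subalgebra_generated G"
| mult: "x \<in> subalgebra_generated G \<Longrightarrow> y \<in> subalgebra_generated G \<Longrightarrow>
    x * y \<in> subalgebra_generated G"

definition left_part :: "real ^ ('p::finite + 'q::finite) \<Rightarrow> real ^ 'p" where
  "left_part X = (\<chi> j. X $ Inl j)"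

definition right_part :: "real ^ ('p::finite + 'q::finite) \<Rightarrow> real ^ 'q" where
  "right_part X = (\<chi> j. X $ Inr j)"

definition left_vector :: "real ^ 'p \<Rightarrow> ('p::finite + 'q::finite) clifford" where
  "left_vector x = (\<Sum>j\<in>UNIV. (x $ j) *\<^sub>R gen (Inl j))"

definition right_vector :: "real ^ 'q \<Rightarrow> ('p::finite + 'q::finite) clifford" where
  "right_vector y = (\<Sum>j\<in>UNIV. (y $ j) *\<^sub>R gen (Inr j))"

definition left_subalgebra :: "('p::{finite,linorder} + 'q::{finite,linorder}) clifford set" where
  "left_subalgebra = subalgebra_generated (range (\<lambda>j. gen (Inl j)))"

definition right_subalgebra :: "('p::{finite,linorder} + 'q::{finite,linorder}) clifford set" where
  "right_subalgebra = subalgebra_generated (range (\<lambda>j. gen (Inr j)))"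

text \<open>The zero polynomial is homogeneous of every degree.\<close>

definition homogeneous_polynomial ::
    "'a::real_vector set \<Rightarrow> nat \<Rightarrow> (real ^ 'n::finite \<Rightarrow> 'a) \<Rightarrow> bool" where
  "homogeneous_polynomial R d H \<longleftrightarrow>
    (\<exists>c :: ('n \<Rightarrow> nat) \<Rightarrow> 'a. range c \<subseteq> R \<and>
      (\<forall>x. H x = (\<Sum>\<alpha> | (\<Sum>i\<in>UNIV. \<alpha> i) = d. (\<Prod>i\<in>UNIV. (x $ i) ^ \<alpha> i) *\<^sub>R c \<alpha>)))"

lemma finite_multi_indices: "finite {\<alpha> :: 'n::finite \<Rightarrow> nat. (\<Sum>i\<in>UNIV. \<alpha> i) = d}"
proof (rule finite_subset)
  show "{\<alpha> :: 'n \<Rightarrow> nat. (\<Sum>i\<in>UNIV. \<alpha> i) = d} \<subseteq> (\<Pi>\<^sub>E i\<in>UNIV. {..d})"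
  proof safe
    fix \<alpha> :: "'n \<Rightarrow> nat" and i
    show "\<alpha> i \<le> (\<Sum>i\<in>UNIV. \<alpha> i)"
      by (rule member_le_sum) auto
  qed auto
  show "finite (\<Pi>\<^sub>E i\<in>(UNIV :: 'n set). {..d})"
    by (rule finite_PiE) auto
qed

definition partial_deriv ::
    "'n::finite \<Rightarrow> (real ^ 'n \<Rightarrow> 'a::real_normed_vector) \<Rightarrow> real ^ 'n \<Rightarrow> 'a" where
  "partial_deriv j F X = vector_derivative (\<lambda>t. F (X + t *\<^sub>R axis j 1)) (at 0)"

definition laplacian ::
    "(real ^ 'n::finite \<Rightarrow> 'a::real_normed_vector) \<Rightarrow> real ^ 'n \<Rightarrow> 'a" where
  "laplacian F X = (\<Sum>j\<in>UNIV. partial_deriv j (partial_deriv j F) X)"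

definition dirac ::
    "(real ^ 'n::{finite,linorder} \<Rightarrow> 'n clifford) \<Rightarrow>
      real ^ 'n::{finite,linorder} \<Rightarrow> 'n clifford" where
  "dirac F X = (\<Sum>j\<in>UNIV. gen j * partial_deriv j F X)"

definition continuously_differentiable_on ::
    "('a::real_normed_vector \<Rightarrow> 'b::real_normed_vector) \<Rightarrow> 'a set \<Rightarrow> bool" where
  "continuously_differentiable_on F S \<longleftrightarrow>
    (\<exists>F' :: 'a \<Rightarrow> 'a \<Rightarrow>\<^sub>L 'b.
      (\<forall>x\<in>S. (F has_derivative blinfun_apply (F' x)) (at x)) \<and> continuous_on S F')"

definition monogenic_on ::
    "(real ^ 'n::{finite,linorder} \<Rightarrow> 'n clifford) \<Rightarrow> (real ^ 'n::{finite,linorder}) set \<Rightarrow> bool" where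
  "monogenic_on F S \<longleftrightarrow>
    open S \<and> continuously_differentiable_on F S \<and> (\<forall>X\<in>S. dirac F X = 0)"

definition wirtinger_deriv :: "(complex \<Rightarrow> complex) \<Rightarrow> complex \<Rightarrow> complex" where
  "wirtinger_deriv w z =
    (vector_derivative (\<lambda>t. w (z + of_real t)) (at 0)
      - \<i> * vector_derivative (\<lambda>t. w (z + \<i> * of_real t)) (at 0)) / 2"

text \<open>Differentiability is meant in the real sense, i.e. as a function on \<open>\<real>\<^sup>2\<close>.\<close>

definition antiholomorphic_on :: "(complex \<Rightarrow> complex) \<Rightarrow> complex set \<Rightarrow> bool" where
  "antiholomorphic_on w S \<longleftrightarrow> (\<forall>z\<in>S. w differentiable (at z) \<and> wirtinger_deriv w z = 0)"

end

theory Submission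
  imports Defs "HOL-Complex_Analysis.Cauchy_Integral_Formula"
begin

text \<open>
  Write \<open>r = |x|\<close>, \<open>\<rho> = |y|\<close>, \<open>\<partial>\<close> for the Dirac operator, \<open>p = 2 a + 1\<close> and \<open>q = 2 b + 1\<close>, so that
  \<open>(m - 2)/2 = a + b\<close>. The proof separates the polynomials from the two radii.

  \<^emph>\<open>The polynomials.\<close> If \<open>F\<close> is smooth and \<open>\<partial>\<Delta>\<^sup>n F = 0\<close>, then \<open>\<partial>\<Delta>\<^sup>n\<^sup>+\<^sup>1 (x\<^sub>i F) = 0\<close>
  (\<open>premonogenic_coord_scaleR\<close>): the commutator of \<open>\<Delta>\<^sup>n\<^sup>+\<^sup>1\<close> and \<open>x\<^sub>i\<close> is \<open>2 (n + 1) \<partial>\<^sub>i \<Delta>\<^sup>n\<close>, and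
  \<open>\<Delta> = - \<partial>\<^sup>2\<close>. Constants that multiply from the right commute with \<open>\<partial>\<close> and \<open>\<Delta>\<close>. Expanding \<open>H\<^sub>k\<close> and
  \<open>H\<^sub>l\<close> into monomials with coefficients on the right, one additional Laplacian per degree
  (\<open>premonogenic_mult_homogeneous\<close>) therefore reduces the statement to \<open>H\<^sub>k = H\<^sub>l = 1\<close>.

  \<^emph>\<open>The Dirac operator.\<close> The function \<open>f = u - \<i> v\<close> is holomorphic. In \<open>\<partial>F\<close> the Cauchy-Riemann
  equations cancel all derivatives of \<open>u\<close> and \<open>v\<close>, and only the terms that come from differentiating
  the unit vectors remain: with \<open>W = v/(r \<rho>)\<close> the result is \<open>2 b W x - 2 a W y\<close> for the first function
  (\<open>dirac_bivector_form\<close>) and \<open>- 2 a u/r - 2 b v/\<rho>\<close> for the second one (\<open>dirac_vector_form\<close>).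
  It has to be shown that \<open>\<Delta>\<^sup>a\<^sup>+\<^sup>b\<close> annihilates these terms.

  \<^emph>\<open>The radii.\<close> On functions of \<open>r\<close> and \<open>\<rho>\<close> the Laplacian is \<open>\<Delta>\<^sub>p\<^sub>q\<close>, the sum of the radial Laplacians
  in dimensions \<open>p\<close> and \<open>q\<close>; and \<open>\<Delta> (x\<^sub>i g) = x\<^sub>i \<Delta>\<^sub>p\<^sub>+\<^sub>2\<^sub>,\<^sub>q g\<close>. The operator \<open>T = r\<^sup>-\<^sup>1 d/dr\<close> satisfies
  \<open>T \<Delta>\<^sub>c\<^sub>d = \<Delta>\<^sub>c\<^sub>+\<^sub>2\<^sub>,\<^sub>d T\<close> and \<open>\<Delta>\<^sub>c\<^sub>+\<^sub>2\<^sub>,\<^sub>d - \<Delta>\<^sub>c\<^sub>d = 2 T\<close>. Hence, if \<open>\<Delta>\<^sub>c\<^sub>d g = 0\<close>, each application of the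
  operator whose dimensions exceed \<open>c\<close> and \<open>d\<close> by \<open>2 i\<close> and \<open>2 j\<close> brings one of them two steps closer, and
  \<open>i + j + 1\<close> applications give zero (\<open>bessel_pair_funpow_eq_0\<close>). The starting points are the
  harmonicity of \<open>u\<close> and \<open>v\<close> as functions of two variables and the fact that division by \<open>r\<close> turns
  \<open>d\<^sup>2/dr\<^sup>2\<close> into the three-dimensional radial Laplacian: \<open>u/r\<close>, \<open>v/\<rho>\<close> and \<open>W\<close> are annihilated in
  dimensions \<open>(3, 1)\<close>, \<open>(1, 3)\<close> and \<open>(3, 3)\<close>. In all cases the count \<open>i + j + 1\<close> is \<open>a + b\<close>.
\<close>

section \<open>Calculus of smooth functions on an open set\<close>

lemma partial_deriv_eq_frechet:
  assumes "(f has_derivative f') (at X)"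
  shows "partial_deriv j f X = f' (axis j 1)"
proof -
  have "((\<lambda>t. X + t *\<^sub>R axis j 1) has_derivative (\<lambda>t. t *\<^sub>R axis j 1)) (at 0)"
    by (auto intro!: derivative_eq_intros)
  then have "((\<lambda>t. f (X + t *\<^sub>R axis j 1)) has_derivative (\<lambda>t. f' (t *\<^sub>R axis j 1))) (at 0)"
    by (rule has_derivative_compose) (use assms in simp)
  moreover have "f' (t *\<^sub>R axis j 1) = t *\<^sub>R f' (axis j 1)" for t
    using linear_cmul[OF has_derivative_linear[OF assms]] .
  ultimately show ?thesis
    unfolding partial_deriv_def by (intro vector_derivative_at) (simp add: has_vector_derivative_def)
qed

lemma has_derivative_partial_derivs:
  assumes "f differentiable (at X)"
  shows "(f has_derivative (\<lambda>h. \<Sum>j\<in>UNIV. (h $ j) *\<^sub>R partial_deriv j f X)) (at X)"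
proof -
  obtain f' where f': "(f has_derivative f') (at X)"
    using assms by (auto simp: differentiable_def)
  have "f' h = (\<Sum>j\<in>UNIV. (h $ j) *\<^sub>R partial_deriv j f X)" for h
  proof -
    have "f' h = f' (\<Sum>j\<in>UNIV. (h $ j) *\<^sub>R axis j 1)"
      by (simp add: basis_expansion flip: scalar_mult_eq_scaleR)
    also have "\<dots> = (\<Sum>j\<in>UNIV. (h $ j) *\<^sub>R f' (axis j 1))"
      using has_derivative_linear[OF f'] by (simp add: linear_sum linear_cmul)
    finally show ?thesis
      by (simp add: partial_deriv_eq_frechet[OF f'])
  qed
  then have "f' = (\<lambda>h. \<Sum>j\<in>UNIV. (h $ j) *\<^sub>R partial_deriv j f X)"
    by (rule ext)
  with f' show ?thesis
    by simp
qed

text \<open>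
  Level \<open>0\<close> imposes no condition: continuity of each derivative follows from the differentiability that
  the next level requires.
\<close>

primrec differentiable_times_on ::
    "nat \<Rightarrow> (real ^ 'n::finite) set \<Rightarrow> (real ^ 'n \<Rightarrow> 'a::real_normed_vector) \<Rightarrow> bool" where
  "differentiable_times_on 0 S f \<longleftrightarrow> True"
| "differentiable_times_on (Suc n) S f \<longleftrightarrow>
    (\<forall>X\<in>S. f differentiable (at X)) \<and> (\<forall>j. differentiable_times_on n S (partial_deriv j f))"

definition smooth_on :: "(real ^ 'n::finite) set \<Rightarrow> (real ^ 'n \<Rightarrow> 'a::real_normed_vector) \<Rightarrow> bool" where
  "smooth_on S f \<longleftrightarrow> (\<forall>n. differentiable_times_on n S f)"

lemma smooth_onI: "(\<And>n. differentiable_times_on n S f) \<Longrightarrow> smooth_on S f"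
  by (simp add: smooth_on_def)

lemma smooth_on_times: "smooth_on S f \<Longrightarrow> differentiable_times_on n S f"
  by (simp add: smooth_on_def)

lemma smooth_on_differentiable: "smooth_on S f \<Longrightarrow> X \<in> S \<Longrightarrow> f differentiable (at X)"
  using smooth_on_times[of S f "Suc 0"] by simp

lemma smooth_on_partial: "smooth_on S f \<Longrightarrow> smooth_on S (partial_deriv j f)"
proof (rule smooth_onI)
  fix n
  show "smooth_on S f \<Longrightarrow> differentiable_times_on n S (partial_deriv j f)"
    using smooth_on_times[of S f "Suc n"] by simp
qed

lemma differentiable_times_on_SucD:
  "differentiable_times_on (Suc n) S f \<Longrightarrow> differentiable_times_on n S f"
  by (induction n arbitrary: f) auto

lemma partial_deriv_add:
  assumes "f differentiable (at X)" "g differentiable (at X)"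
  shows "partial_deriv j (\<lambda>X. f X + g X) X = partial_deriv j f X + partial_deriv j g X"
proof -
  obtain f' g' where "(f has_derivative f') (at X)" "(g has_derivative g') (at X)"
    using assms by (auto simp: differentiable_def)
  note D = this
  show ?thesis
    unfolding partial_deriv_eq_frechet[OF D(1)] partial_deriv_eq_frechet[OF D(2)]
      partial_deriv_eq_frechet[OF has_derivative_add[OF D]] ..
qed

lemma partial_deriv_sum:
  assumes "\<And>a. a \<in> A \<Longrightarrow> f a differentiable (at X)"
  shows "partial_deriv j (\<lambda>X. \<Sum>a\<in>A. f a X) X = (\<Sum>a\<in>A. partial_deriv j (f a) X)"
proof -
  obtain f' where f': "\<And>a. a \<in> A \<Longrightarrow> (f a has_derivative f' a) (at X)"
    using assms unfolding differentiable_def by metis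
  show ?thesis
    by (subst partial_deriv_eq_frechet[OF has_derivative_sum, of A f f'])
      (auto intro!: sum.cong simp: f' partial_deriv_eq_frechet[OF f'])
qed

lemma partial_deriv_linear:
  assumes "bounded_linear L" "f differentiable (at X)"
  shows "partial_deriv j (\<lambda>X. L (f X)) X = L (partial_deriv j f X)"
proof -
  obtain f' where f': "(f has_derivative f') (at X)"
    using assms by (auto simp: differentiable_def)
  show ?thesis
    unfolding partial_deriv_eq_frechet[OF f']
      partial_deriv_eq_frechet[OF bounded_linear.has_derivative[OF assms(1) f']] ..
qed

lemma partial_deriv_bilinear:
  assumes "bounded_bilinear B" "f differentiable (at X)" "g differentiable (at X)"
  shows "partial_deriv j (\<lambda>X. B (f X) (g X)) X
      = B (partial_deriv j f X) (g X) + B (f X) (partial_deriv j g X)"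
proof -
  obtain f' g' where "(f has_derivative f') (at X)" "(g has_derivative g') (at X)"
    using assms by (auto simp: differentiable_def)
  note D = this
  show ?thesis
    unfolding partial_deriv_eq_frechet[OF D(1)] partial_deriv_eq_frechet[OF D(2)]
      partial_deriv_eq_frechet[OF bounded_bilinear.FDERIV[OF assms(1) D]] by (rule add.commute)
qed

lemma partial_deriv_const [simp]: "partial_deriv j (\<lambda>X. c) = (\<lambda>X. 0)"
  by (rule ext) (simp add: partial_deriv_def)

lemma partial_deriv_coord:
  "partial_deriv j (\<lambda>X :: real ^ 'n::finite. X $ i) = (\<lambda>X. if i = j then 1 else 0)"
proof
  fix X :: "real ^ 'n"
  have "((\<lambda>X :: real ^ 'n. X $ i) has_derivative (\<lambda>h. h $ i)) (at X)"
    by (rule bounded_linear_imp_has_derivative) (rule bounded_linear_vec_nth)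
  from partial_deriv_eq_frechet[OF this] show "partial_deriv j (\<lambda>X. X $ i) X = (if i = j then 1 else 0)"
    by (simp add: axis_def)
qed

lemma bounded_bilinear_differentiable:
  assumes "bounded_bilinear B" "f differentiable (at X)" "g differentiable (at X)"
  shows "(\<lambda>X. B (f X) (g X)) differentiable (at X)"
  using assms bounded_bilinear.FDERIV[OF assms(1)] unfolding differentiable_def by blast

text \<open>
  The second difference of \<open>f\<close> over a square of side \<open>t\<close> equals \<open>t\<^sup>2\<close> times \<open>\<partial>\<^sub>j\<partial>\<^sub>i f\<close>, up to an error
  \<open>o(t\<^sup>2)\<close>: the mean value inequality in direction \<open>i\<close> reduces it to an increment of \<open>\<partial>\<^sub>i f\<close>, to which
  differentiability at the corner applies. The second difference is symmetric in \<open>i\<close> and \<open>j\<close>.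
\<close>

lemma second_difference_bound:
  fixes f :: "real ^ 'n::finite \<Rightarrow> 'a::real_normed_vector"
  assumes S: "open S" "X \<in> S" and f: "\<forall>Y\<in>S. f differentiable (at Y)"
    and fi: "partial_deriv i f differentiable (at X)" and e: "e > 0"
  shows "\<forall>\<^sub>F t in at_right 0. norm (f (X + t *\<^sub>R axis i 1 + t *\<^sub>R axis j 1) - f (X + t *\<^sub>R axis i 1)
      - f (X + t *\<^sub>R axis j 1) + f X - t\<^sup>2 *\<^sub>R partial_deriv j (partial_deriv i f) X) \<le> e * t\<^sup>2"
proof -
  let ?a = "axis i 1 :: real ^ 'n" and ?b = "axis j 1 :: real ^ 'n"
  let ?A = "partial_deriv i f"
  obtain A' where A': "(?A has_derivative A') (at X)"
    using fi by (auto simp: differentiable_def)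
  interpret A': bounded_linear A'
    using A' by (rule has_derivative_bounded_linear)
  have A'b: "A' ?b = partial_deriv j ?A X"
    by (simp add: partial_deriv_eq_frechet[OF A'])
  obtain d1 where d1: "d1 > 0" and
    d1': "\<And>Y. norm (Y - X) < d1 \<Longrightarrow> norm (?A Y - ?A X - A' (Y - X)) \<le> (e/3) * norm (Y - X)"
    using A' e unfolding has_derivative_at_alt by (metis divide_pos_pos zero_less_numeral)
  obtain d2 where d2: "d2 > 0" "ball X d2 \<subseteq> S"
    using S open_contains_ball by blast
  define d where "d = min d1 d2 / 2"
  have d: "d > 0" "2 * d \<le> d1" "2 * d \<le> d2"
    using d1 d2 by (auto simp: d_def)
  have bound: "norm (f (X + t *\<^sub>R ?a + t *\<^sub>R ?b) - f (X + t *\<^sub>R ?a)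
      - f (X + t *\<^sub>R ?b) + f X - t\<^sup>2 *\<^sub>R partial_deriv j ?A X) \<le> e * t\<^sup>2" if t: "0 < t" "t < d" for t
  proof -
    define \<psi> where "\<psi> = (\<lambda>s. f (X + s *\<^sub>R ?a + t *\<^sub>R ?b) - f (X + s *\<^sub>R ?a) - (s * t) *\<^sub>R A' ?b)"
    have nb: "norm (s *\<^sub>R ?a + t *\<^sub>R ?b) \<le> 2 * t" "norm (s *\<^sub>R ?a) \<le> t" if "s \<in> {0..t}" for s
    proof -
      show *: "norm (s *\<^sub>R ?a) \<le> t"
        using that by (simp add: norm_axis_1)
      have "norm (t *\<^sub>R ?b) \<le> t"
        using t by (simp add: norm_axis_1)
      then show "norm (s *\<^sub>R ?a + t *\<^sub>R ?b) \<le> 2 * t"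
        using norm_triangle_ineq[of "s *\<^sub>R ?a" "t *\<^sub>R ?b"] * by linarith
    qed
    have der: "(\<psi> has_derivative (\<lambda>h. h *\<^sub>R (?A (X + s *\<^sub>R ?a + t *\<^sub>R ?b) - ?A (X + s *\<^sub>R ?a)
        - t *\<^sub>R A' ?b))) (at s within {0..t})" if s: "s \<in> {0..t}" for s
    proof -
      have in1: "X + s *\<^sub>R ?a + t *\<^sub>R ?b \<in> S" and in2: "X + s *\<^sub>R ?a \<in> S"
      proof -
        have *: "X - (X + z) = - z" for z
          by simp
        have "dist X (X + (s *\<^sub>R ?a + t *\<^sub>R ?b)) < d2" "dist X (X + s *\<^sub>R ?a) < d2"
          using nb[OF s] t d unfolding dist_norm * norm_minus_cancel by linarith+
        then show "X + s *\<^sub>R ?a + t *\<^sub>R ?b \<in> S" "X + s *\<^sub>R ?a \<in> S"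
          using d2(2) by (auto simp: add.assoc)
      qed
      have line: "((\<lambda>s. f (Y s)) has_derivative (\<lambda>h. h *\<^sub>R ?A (Y s))) (at s within {0..t})"
        if Y: "Y = (\<lambda>s. c + s *\<^sub>R ?a)" "Y s \<in> S" for Y c
      proof -
        obtain f' where f': "(f has_derivative f') (at (Y s))"
          using bspec[OF f Y(2)] by (auto simp: differentiable_def)
        have "(Y has_derivative (\<lambda>h. h *\<^sub>R ?a)) (at s within {0..t})"
          unfolding Y by (auto intro!: derivative_eq_intros)
        from has_derivative_compose[OF this f']
        show ?thesis
          by (simp add: partial_deriv_eq_frechet[OF f'] linear_cmul[OF has_derivative_linear[OF f']])
      qed
      have 1: "((\<lambda>s. f (X + s *\<^sub>R ?a + t *\<^sub>R ?b)) has_derivative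
          (\<lambda>h. h *\<^sub>R ?A (X + s *\<^sub>R ?a + t *\<^sub>R ?b))) (at s within {0..t})"
        by (rule line[of _ "X + t *\<^sub>R ?b"]) (use in1 in \<open>auto simp: algebra_simps\<close>)
      have 2: "((\<lambda>s. f (X + s *\<^sub>R ?a)) has_derivative
          (\<lambda>h. h *\<^sub>R ?A (X + s *\<^sub>R ?a))) (at s within {0..t})"
        by (rule line[of _ "X"]) (use in2 in auto)
      show ?thesis
        unfolding \<psi>_def by (rule derivative_eq_intros 1 2 refl | simp add: algebra_simps)+
    qed
    have "norm (\<psi> t - \<psi> 0) \<le> (e * t) * norm (t - 0)"
    proof (rule differentiable_bound[OF _ der])
      fix s assume s: "s \<in> {0..t}"
      define Y where "Y = X + s *\<^sub>R ?a + t *\<^sub>R ?b"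
      define Z where "Z = X + s *\<^sub>R ?a"
      have Y: "norm (?A Y - ?A X - A' (Y - X)) \<le> (e/3) * (2 * t)"
      proof -
        have "norm (Y - X) \<le> 2 * t"
          using nb[OF s] by (simp add: Y_def add.assoc)
        then show ?thesis
          using d1'[of Y] t d e by (smt (verit) divide_pos_pos mult_left_mono)
      qed
      have Z: "norm (?A Z - ?A X - A' (Z - X)) \<le> (e/3) * t"
      proof -
        have "norm (Z - X) \<le> t"
          using nb[OF s] by (simp add: Z_def add.assoc)
        then show ?thesis
          using d1'[of Z] t d e by (smt (verit) divide_pos_pos mult_left_mono)
      qed
      have "A' (Y - X) - A' (Z - X) = t *\<^sub>R A' ?b"
        by (simp add: Y_def Z_def A'.scaleR A'.add add.assoc)
      then have "?A Y - ?A Z - t *\<^sub>R A' ?b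
          = (?A Y - ?A X - A' (Y - X)) - (?A Z - ?A X - A' (Z - X))"
        by (simp add: algebra_simps)
      then have "norm (?A Y - ?A Z - t *\<^sub>R A' ?b)
          \<le> norm (?A Y - ?A X - A' (Y - X)) + norm (?A Z - ?A X - A' (Z - X))"
        by (simp only: norm_triangle_ineq4)
      also have "\<dots> \<le> e * t"
        using Y Z by (simp add: field_simps)
      finally have "norm (?A Y - ?A Z - t *\<^sub>R A' ?b) \<le> e * t" .
      then show "onorm (\<lambda>h. h *\<^sub>R (?A (X + s *\<^sub>R ?a + t *\<^sub>R ?b) - ?A (X + s *\<^sub>R ?a)
        - t *\<^sub>R A' ?b)) \<le> e * t"
        by (intro onorm_bound) (use e t in \<open>auto simp: Y_def Z_def mult_left_mono mult.commute\<close>)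
    qed (use t in auto)
    moreover have "\<psi> t - \<psi> 0 = f (X + t *\<^sub>R ?a + t *\<^sub>R ?b) - f (X + t *\<^sub>R ?a)
      - f (X + t *\<^sub>R ?b) + f X - t\<^sup>2 *\<^sub>R partial_deriv j ?A X"
      by (simp add: \<psi>_def A'b power2_eq_square)
    ultimately show ?thesis
      using t by (simp add: power2_eq_square mult.assoc)
  qed
  then show ?thesis
    unfolding eventually_at_right_field using d(1) by (intro exI[of _ d]) auto
qed

lemma partial_deriv_commute:
  fixes f :: "real ^ 'n::finite \<Rightarrow> 'a::real_normed_vector"
  assumes S: "open S" "X \<in> S" and f: "smooth_on S f"
  shows "partial_deriv i (partial_deriv j f) X = partial_deriv j (partial_deriv i f) X"
proof (rule ccontr)
  define u where "u = partial_deriv j (partial_deriv i f) X"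
  define v where "v = partial_deriv i (partial_deriv j f) X"
  assume "\<not> ?thesis"
  then have ne: "norm (u - v) > 0"
    by (simp add: u_def v_def)
  define e where "e = norm (u - v) / 3"
  have e: "e > 0"
    using ne by (simp add: e_def)
  have "\<forall>Y\<in>S. f differentiable (at Y)"
    using smooth_on_differentiable[OF f] by blast
  note sd = second_difference_bound[OF S this
      smooth_on_differentiable[OF smooth_on_partial[OF f] S(2)] e]
  have "\<forall>\<^sub>F t in at_right (0::real). norm (t\<^sup>2 *\<^sub>R (u - v)) \<le> 2 * e * t\<^sup>2"
    using sd[of i j] sd[of j i]
  proof eventually_elim
    case (elim t)
    define w where "w = f (X + t *\<^sub>R axis i 1 + t *\<^sub>R axis j 1) - f (X + t *\<^sub>R axis i 1)
      - f (X + t *\<^sub>R axis j 1) + f X"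
    have "norm (w - t\<^sup>2 *\<^sub>R u) \<le> e * t\<^sup>2" "norm (w - t\<^sup>2 *\<^sub>R v) \<le> e * t\<^sup>2"
      using elim by (simp_all add: w_def u_def v_def algebra_simps)
    then have "norm ((w - t\<^sup>2 *\<^sub>R v) - (w - t\<^sup>2 *\<^sub>R u)) \<le> e * t\<^sup>2 + e * t\<^sup>2"
      using norm_triangle_ineq4 by (smt (verit))
    then show ?case
      by (simp add: algebra_simps)
  qed
  moreover have "\<forall>\<^sub>F t in at_right (0::real). t > 0"
    by (simp add: eventually_at_right_less)
  ultimately have "\<forall>\<^sub>F t in at_right (0::real). False"
  proof eventually_elim
    case (elim t)
    then have "norm (u - v) \<le> 2 * e"
      by (simp add: mult.commute)
    then show False
      using ne by (simp add: e_def)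
  qed
  then show False
    by simp
qed

locale open_domain =
  fixes S :: "(real ^ 'n::finite) set"
  assumes open_domain: "open S"
begin

lemma partial_deriv_cong:
  assumes "\<And>X. X \<in> S \<Longrightarrow> f X = g X" "X \<in> S"
  shows "partial_deriv j f X = partial_deriv j g X"
proof -
  have "((\<lambda>t. X + t *\<^sub>R axis j 1) \<longlongrightarrow> X + 0 *\<^sub>R axis j 1) (nhds 0)"
    by (intro tendsto_intros filterlim_ident)
  then have "\<forall>\<^sub>F t in nhds 0. X + t *\<^sub>R axis j 1 \<in> S"
    using open_domain assms(2) by (simp add: tendsto_def)
  then have "\<forall>\<^sub>F t in nhds 0. f (X + t *\<^sub>R axis j 1) = g (X + t *\<^sub>R axis j 1)"
    by eventually_elim (rule assms(1))
  then show ?thesis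
    unfolding partial_deriv_def by (intro vector_derivative_cong_eq) auto
qed

lemma differentiable_cong:
  assumes "\<And>X. X \<in> S \<Longrightarrow> f X = g X" "X \<in> S" "f differentiable (at X)"
  shows "g differentiable (at X)"
  using assms has_derivative_transform_within_open[OF _ open_domain]
  unfolding differentiable_def by metis

lemma differentiable_times_on_cong:
  "differentiable_times_on n S f \<Longrightarrow> (\<And>X. X \<in> S \<Longrightarrow> f X = g X) \<Longrightarrow> differentiable_times_on n S g"
proof (induction n arbitrary: f g)
  case (Suc n)
  have "\<And>j X. X \<in> S \<Longrightarrow> partial_deriv j f X = partial_deriv j g X"
    using Suc.prems(2) by (rule partial_deriv_cong)
  then have "differentiable_times_on n S (partial_deriv j g)" for j
    using Suc.IH[of "partial_deriv j f" "partial_deriv j g"] Suc.prems(1) by simp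
  with Suc.prems show ?case
    by (auto intro: differentiable_cong[of f g])
qed simp

lemma smooth_on_cong:
  "smooth_on S f \<Longrightarrow> (\<And>X. X \<in> S \<Longrightarrow> f X = g X) \<Longrightarrow> smooth_on S g"
  unfolding smooth_on_def using differentiable_times_on_cong by blast

lemma differentiable_times_on_add:
  "differentiable_times_on n S f \<Longrightarrow> differentiable_times_on n S g \<Longrightarrow>
    differentiable_times_on n S (\<lambda>X. f X + g X)"
proof (induction n arbitrary: f g)
  case (Suc n)
  have "differentiable_times_on n S (partial_deriv j (\<lambda>X. f X + g X))" for j
    by (rule differentiable_times_on_cong[of n "\<lambda>X. partial_deriv j f X + partial_deriv j g X"])
      (use Suc in \<open>auto simp: partial_deriv_add\<close>)
  with Suc.prems show ?case
    by (auto intro: differentiable_add)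
qed simp

lemma differentiable_times_on_bilinear:
  assumes B: "bounded_bilinear B"
  shows "differentiable_times_on n S f \<Longrightarrow> differentiable_times_on n S g \<Longrightarrow>
    differentiable_times_on n S (\<lambda>X. B (f X) (g X))"
proof (induction n arbitrary: f g)
  case (Suc n)
  have "differentiable_times_on n S (partial_deriv j (\<lambda>X. B (f X) (g X)))" for j
    by (rule differentiable_times_on_cong[OF differentiable_times_on_add[OF Suc.IH Suc.IH],
          of "partial_deriv j f" g f "partial_deriv j g"])
      (use Suc.prems differentiable_times_on_SucD[of n S] in
        \<open>auto simp: partial_deriv_bilinear[OF B]\<close>)
  with Suc.prems show ?case
    by (auto intro: bounded_bilinear_differentiable[OF B])
qed simp

lemma smooth_on_const: "smooth_on S (\<lambda>X. c)"
proof (rule smooth_onI)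
  have "differentiable_times_on n S (\<lambda>X. c)" for n and c :: "'b::real_normed_vector"
    by (induction n arbitrary: c) simp_all
  then show "differentiable_times_on n S (\<lambda>X. c)" for n .
qed

lemma smooth_on_coord: "smooth_on S (\<lambda>X. X $ i)"
proof (rule smooth_onI)
  fix n
  have "(\<lambda>X :: real ^ 'n. X $ i) differentiable (at X)" for X
    by (intro bounded_linear_imp_differentiable bounded_linear_vec_nth)
  then show "differentiable_times_on n S (\<lambda>X. X $ i)"
    using smooth_on_times[OF smooth_on_const[of 0]] smooth_on_times[OF smooth_on_const[of 1]]
    by (cases n) (auto simp: partial_deriv_coord)
qed

lemma smooth_on_add: "smooth_on S f \<Longrightarrow> smooth_on S g \<Longrightarrow> smooth_on S (\<lambda>X. f X + g X)"
  by (simp add: smooth_on_def differentiable_times_on_add)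

lemma smooth_on_bilinear:
  "bounded_bilinear B \<Longrightarrow> smooth_on S f \<Longrightarrow> smooth_on S g \<Longrightarrow> smooth_on S (\<lambda>X. B (f X) (g X))"
  by (simp add: smooth_on_def differentiable_times_on_bilinear)

lemma smooth_on_scaleR:
  "smooth_on S f \<Longrightarrow> smooth_on S g \<Longrightarrow> smooth_on S (\<lambda>X. f X *\<^sub>R g X)"
  by (rule smooth_on_bilinear[OF bounded_bilinear_scaleR])

lemma smooth_on_mult:
  fixes f g :: "_ \<Rightarrow> 'b::real_normed_algebra"
  shows "smooth_on S f \<Longrightarrow> smooth_on S g \<Longrightarrow> smooth_on S (\<lambda>X. f X * g X)"
  by (rule smooth_on_bilinear[OF bounded_bilinear_mult])

lemma smooth_on_sum:
  "(\<And>a. a \<in> A \<Longrightarrow> smooth_on S (f a)) \<Longrightarrow> smooth_on S (\<lambda>X. \<Sum>a\<in>A. f a X)"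
  by (induction A rule: infinite_finite_induct) (auto intro: smooth_on_const smooth_on_add)

lemma smooth_on_linear:
  assumes L: "bounded_linear L" and f: "smooth_on S f"
  shows "smooth_on S (\<lambda>X. L (f X))"
proof -
  have "bounded_bilinear (\<lambda>(c :: real) x. c *\<^sub>R L x)"
    using bounded_bilinear.comp[OF bounded_bilinear_scaleR bounded_linear_ident L] by simp
  from smooth_on_bilinear[OF this smooth_on_const[of 1] f] show ?thesis
    by simp
qed

lemmas smooth_intros = smooth_on_add smooth_on_scaleR smooth_on_sum smooth_on_const
  smooth_on_coord smooth_on_partial

lemma partial_deriv_scaleR_smooth:
  assumes "smooth_on S h" "smooth_on S f" "X \<in> S"
  shows "partial_deriv j (\<lambda>X. h X *\<^sub>R f X) X = partial_deriv j h X *\<^sub>R f X + h X *\<^sub>R partial_deriv j f X"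
  by (rule partial_deriv_bilinear[OF bounded_bilinear_scaleR]) (use assms smooth_on_differentiable in auto)

lemma partial_deriv_coord_scaleR:
  assumes "smooth_on S f" "X \<in> S"
  shows "partial_deriv j (\<lambda>X. X $ i *\<^sub>R f X) X = (if i = j then f X else 0) + X $ i *\<^sub>R partial_deriv j f X"
  using partial_deriv_scaleR_smooth[OF smooth_on_coord assms] by (simp add: partial_deriv_coord)

end

text \<open>
  The operators that occur below are linear on smooth functions and compatible with restriction to
  \<open>S\<close>, so that identities which hold on \<open>S\<close> may be differentiated. Both properties pass to powers.
\<close>

definition local_linear_operator ::
    "(real ^ 'n::finite) set \<Rightarrow>
      ((real ^ 'n \<Rightarrow> 'a::real_normed_vector) \<Rightarrow> real ^ 'n \<Rightarrow> 'a) \<Rightarrow> bool" where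
  "local_linear_operator S T \<longleftrightarrow>
    (\<forall>f. smooth_on S f \<longrightarrow> smooth_on S (T f)) \<and>
    (\<forall>f g. (\<forall>X\<in>S. f X = g X) \<longrightarrow> (\<forall>X\<in>S. T f X = T g X)) \<and>
    (\<forall>f g. smooth_on S f \<longrightarrow> smooth_on S g \<longrightarrow>
      (\<forall>X\<in>S. T (\<lambda>X. f X + g X) X = T f X + T g X)) \<and>
    (\<forall>f c. smooth_on S f \<longrightarrow> (\<forall>X\<in>S. T (\<lambda>X. c *\<^sub>R f X) X = c *\<^sub>R T f X))"

lemma local_linear_operatorI:
  assumes "\<And>f. smooth_on S f \<Longrightarrow> smooth_on S (T f)"
    and "\<And>f g X. (\<And>X. X \<in> S \<Longrightarrow> f X = g X) \<Longrightarrow> X \<in> S \<Longrightarrow> T f X = T g X"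
    and "\<And>f g X. smooth_on S f \<Longrightarrow> smooth_on S g \<Longrightarrow> X \<in> S \<Longrightarrow> T (\<lambda>X. f X + g X) X = T f X + T g X"
    and "\<And>f c X. smooth_on S f \<Longrightarrow> X \<in> S \<Longrightarrow> T (\<lambda>X. c *\<^sub>R f X) X = c *\<^sub>R T f X"
  shows "local_linear_operator S T"
  unfolding local_linear_operator_def using assms by blast

lemma local_linear_operatorD:
  assumes "local_linear_operator S T"
  shows local_linear_operator_smooth: "\<And>f. smooth_on S f \<Longrightarrow> smooth_on S (T f)"
    and local_linear_operator_cong: "\<And>f g X. (\<And>X. X \<in> S \<Longrightarrow> f X = g X) \<Longrightarrow> X \<in> S \<Longrightarrow> T f X = T g X"
    and local_linear_operator_add: "\<And>f g X. smooth_on S f \<Longrightarrow> smooth_on S g \<Longrightarrow> X \<in> S \<Longrightarrow>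
      T (\<lambda>X. f X + g X) X = T f X + T g X"
    and local_linear_operator_scaleR: "\<And>f c X. smooth_on S f \<Longrightarrow> X \<in> S \<Longrightarrow>
      T (\<lambda>X. c *\<^sub>R f X) X = c *\<^sub>R T f X"
  using assms unfolding local_linear_operator_def by blast+

context open_domain
begin

lemma local_linear_operator_zero:
  assumes T: "local_linear_operator S T" and f: "\<And>X. X \<in> S \<Longrightarrow> f X = 0" and X: "X \<in> S"
  shows "T f X = 0"
proof -
  have "T f X = T (\<lambda>X. 0 *\<^sub>R f X) X"
    using f X by (intro local_linear_operator_cong[OF T]) auto
  also have "\<dots> = 0 *\<^sub>R T f X"
    using f by (intro local_linear_operator_scaleR[OF T] X smooth_on_cong[OF smooth_on_const[of 0]]) auto
  finally show ?thesis
    by simp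
qed

lemma local_linear_operator_sum:
  assumes T: "local_linear_operator S T" and f: "\<And>a. a \<in> A \<Longrightarrow> smooth_on S (f a)" and X: "X \<in> S"
  shows "T (\<lambda>X. \<Sum>a\<in>A. f a X) X = (\<Sum>a\<in>A. T (f a) X)"
  using f
proof (induction A rule: infinite_finite_induct)
  case (insert a A)
  have "T (\<lambda>X. f a X + (\<Sum>a\<in>A. f a X)) X = T (f a) X + T (\<lambda>X. \<Sum>a\<in>A. f a X) X"
    using insert.prems X by (intro local_linear_operator_add[OF T] smooth_intros) auto
  with insert show ?case
    by simp
qed (simp_all add: local_linear_operator_zero[OF T _ X])

lemma local_linear_operator_funpow:
  assumes T: "local_linear_operator S T"
  shows "local_linear_operator S (T ^^ n)"
proof (induction n)
  case 0
  show ?case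
    by (rule local_linear_operatorI) auto
next
  case (Suc n)
  note IH = local_linear_operatorD[OF Suc]
  note D = local_linear_operatorD[OF T]
  show ?case
  proof (rule local_linear_operatorI)
    fix f g X
    show "smooth_on S f \<Longrightarrow> smooth_on S ((T ^^ Suc n) f)"
      by (simp add: D(1) IH(1))
    show "X \<in> S \<Longrightarrow> (T ^^ Suc n) f X = (T ^^ Suc n) g X" if "\<And>X. X \<in> S \<Longrightarrow> f X = g X"
      using D(2)[of "(T ^^ n) f" "(T ^^ n) g", OF IH(2)[of f g, OF that]] by simp
    show "(T ^^ Suc n) (\<lambda>X. f X + g X) X = (T ^^ Suc n) f X + (T ^^ Suc n) g X"
      if "smooth_on S f" "smooth_on S g" "X \<in> S"
    proof -
      have "T ((T ^^ n) (\<lambda>X. f X + g X)) X = T (\<lambda>X. (T ^^ n) f X + (T ^^ n) g X) X"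
        using that by (intro D(2)) (auto simp: IH(3,4))
      then show ?thesis
        using that by (simp add: D(3) IH(1))
    qed
    show "(T ^^ Suc n) (\<lambda>X. c *\<^sub>R f X) X = c *\<^sub>R (T ^^ Suc n) f X"
      if "smooth_on S f" "X \<in> S" for c
    proof -
      have "T ((T ^^ n) (\<lambda>X. c *\<^sub>R f X)) X = T (\<lambda>X. c *\<^sub>R (T ^^ n) f X) X"
        using that by (intro D(2)) (auto simp: IH(3,4))
      then show ?thesis
        using that by (simp add: D(4) IH(1))
    qed
  qed
qed

lemma local_linear_operator_funpow_commute:
  assumes T: "local_linear_operator S T" and U: "local_linear_operator S U"
    and comm: "\<And>f X. smooth_on S f \<Longrightarrow> X \<in> S \<Longrightarrow> U (T f) X = T (U f) X"
    and f: "smooth_on S f" and X: "X \<in> S"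
  shows "U ((T ^^ n) f) X = (T ^^ n) (U f) X"
  using X
proof (induction n arbitrary: X)
  case (Suc n)
  have "smooth_on S ((T ^^ n) f)"
    by (intro local_linear_operator_smooth[OF local_linear_operator_funpow[OF T]] f)
  then have "U (T ((T ^^ n) f)) X = T (U ((T ^^ n) f)) X"
    using Suc.prems by (rule comm)
  also have "\<dots> = T ((T ^^ n) (U f)) X"
    using Suc by (intro local_linear_operator_cong[OF T])
  finally show ?case
    by simp
qed simp

lemma local_linear_operator_partial: "local_linear_operator S (partial_deriv j)"
proof (rule local_linear_operatorI)
  fix f g :: "_ \<Rightarrow> 'b::real_normed_vector" and c X
  show "smooth_on S f \<Longrightarrow> smooth_on S (partial_deriv j f)"
    by (rule smooth_on_partial)
  show "(\<And>X. X \<in> S \<Longrightarrow> f X = g X) \<Longrightarrow> X \<in> S \<Longrightarrow> partial_deriv j f X = partial_deriv j g X"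
    by (rule partial_deriv_cong)
  show "smooth_on S f \<Longrightarrow> smooth_on S g \<Longrightarrow> X \<in> S \<Longrightarrow>
      partial_deriv j (\<lambda>X. f X + g X) X = partial_deriv j f X + partial_deriv j g X"
    by (intro partial_deriv_add smooth_on_differentiable)
  show "partial_deriv j (\<lambda>X. c *\<^sub>R f X) X = c *\<^sub>R partial_deriv j f X" if "smooth_on S f" "X \<in> S"
    by (rule partial_deriv_linear[OF bounded_linear_scaleR_right smooth_on_differentiable[OF that]])
qed

end

section \<open>The Laplace and Dirac operators\<close>

context open_domain
begin

lemma local_linear_operator_laplacian: "local_linear_operator S laplacian"
proof -
  note P = local_linear_operatorD[OF local_linear_operator_partial]
  have P2: "local_linear_operator S (\<lambda>f. partial_deriv j (partial_deriv j f))" for j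
    using local_linear_operator_funpow[OF local_linear_operator_partial, of 2 j]
    by (simp add: numeral_2_eq_2 comp_def)
  note P2 = local_linear_operatorD[OF P2]
  show ?thesis
  proof (rule local_linear_operatorI)
    fix f g :: "_ \<Rightarrow> 'b::real_normed_vector" and X c
    show "smooth_on S f \<Longrightarrow> smooth_on S (laplacian f)"
      unfolding laplacian_def[abs_def] by (intro smooth_intros)
    show "(\<And>X. X \<in> S \<Longrightarrow> f X = g X) \<Longrightarrow> X \<in> S \<Longrightarrow> laplacian f X = laplacian g X"
      unfolding laplacian_def by (intro sum.cong refl P2(2))
    show "smooth_on S f \<Longrightarrow> smooth_on S g \<Longrightarrow> X \<in> S \<Longrightarrow>
        laplacian (\<lambda>X. f X + g X) X = laplacian f X + laplacian g X"
      by (simp add: laplacian_def P2(3) sum.distrib)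
    show "smooth_on S f \<Longrightarrow> X \<in> S \<Longrightarrow> laplacian (\<lambda>X. c *\<^sub>R f X) X = c *\<^sub>R laplacian f X"
      by (simp add: laplacian_def P2(4) scaleR_right.sum)
  qed
qed

lemmas laplacian_D = local_linear_operatorD[OF local_linear_operator_laplacian]

lemmas laplacian_funpow_D =
  local_linear_operatorD[OF local_linear_operator_funpow[OF local_linear_operator_laplacian]]

lemma laplacian_linear:
  assumes L: "bounded_linear L" and f: "smooth_on S f" and X: "X \<in> S"
  shows "laplacian (\<lambda>X. L (f X)) X = L (laplacian f X)"
proof -
  interpret L: bounded_linear L by fact
  have "partial_deriv j (partial_deriv j (\<lambda>X. L (f X))) X = L (partial_deriv j (partial_deriv j f) X)" for j
  proof -
    have "partial_deriv j (partial_deriv j (\<lambda>X. L (f X))) X = partial_deriv j (\<lambda>X. L (partial_deriv j f X)) X"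
      by (intro partial_deriv_cong[OF _ X] partial_deriv_linear[OF L] smooth_on_differentiable[OF f])
    then show ?thesis
      using partial_deriv_linear[OF L smooth_on_differentiable[OF smooth_on_partial[OF f] X]] by simp
  qed
  then show ?thesis
    by (simp add: laplacian_def L.sum)
qed

lemma laplacian_funpow_linear:
  assumes L: "bounded_linear L" and f: "smooth_on S f" and X: "X \<in> S"
  shows "(laplacian ^^ n) (\<lambda>X. L (f X)) X = L ((laplacian ^^ n) f X)"
  using X
proof (induction n arbitrary: X)
  case (Suc n)
  have "laplacian ((laplacian ^^ n) (\<lambda>X. L (f X))) X = laplacian (\<lambda>X. L ((laplacian ^^ n) f X)) X"
    using Suc by (intro laplacian_D(2))
  also have "\<dots> = L (laplacian ((laplacian ^^ n) f) X)"
    by (intro laplacian_linear L laplacian_funpow_D f Suc.prems)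
  finally show ?case
    by simp
qed simp

lemma laplacian_funpow_combination:
  assumes G: "smooth_on S G" "smooth_on S H" and X: "X \<in> S"
    and zero: "c \<noteq> 0 \<Longrightarrow> (laplacian ^^ n) G X = 0" "d \<noteq> 0 \<Longrightarrow> (laplacian ^^ n) H X = 0"
  shows "(laplacian ^^ n) (\<lambda>X. c *\<^sub>R G X + d *\<^sub>R H X) X = 0"
proof -
  have "(laplacian ^^ n) (\<lambda>X. c *\<^sub>R G X + d *\<^sub>R H X) X
      = (laplacian ^^ n) (\<lambda>X. c *\<^sub>R G X) X + (laplacian ^^ n) (\<lambda>X. d *\<^sub>R H X) X"
    by (intro laplacian_funpow_D smooth_intros G X)
  also have "\<dots> = c *\<^sub>R (laplacian ^^ n) G X + d *\<^sub>R (laplacian ^^ n) H X"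
    by (simp only: laplacian_funpow_D(4)[OF G(1) X] laplacian_funpow_D(4)[OF G(2) X])
  also have "\<dots> = 0"
    using zero by (metis add_0 scaleR_zero_left scaleR_zero_right)
  finally show ?thesis .
qed

lemma partial_deriv_laplacian:
  assumes f: "smooth_on S f" and X: "X \<in> S"
  shows "partial_deriv i (laplacian f) X = laplacian (partial_deriv i f) X"
proof -
  have "partial_deriv i (laplacian f) X = (\<Sum>j\<in>UNIV. partial_deriv i (partial_deriv j (partial_deriv j f)) X)"
    unfolding laplacian_def[abs_def] using f X
    by (intro local_linear_operator_sum[OF local_linear_operator_partial] smooth_intros)
  also have "\<dots> = (\<Sum>j\<in>UNIV. partial_deriv j (partial_deriv i (partial_deriv j f)) X)"
    by (intro sum.cong refl partial_deriv_commute[OF open_domain X] smooth_intros f)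
  also have "\<dots> = (\<Sum>j\<in>UNIV. partial_deriv j (partial_deriv j (partial_deriv i f)) X)"
    by (intro sum.cong refl partial_deriv_cong[OF _ X] partial_deriv_commute[OF open_domain _ f])
  finally show ?thesis
    by (simp add: laplacian_def)
qed

lemma laplacian_coord_scaleR:
  assumes f: "smooth_on S f" and X: "X \<in> S"
  shows "laplacian (\<lambda>X. X $ i *\<^sub>R f X) X = X $ i *\<^sub>R laplacian f X + 2 *\<^sub>R partial_deriv i f X"
proof -
  have "partial_deriv j (partial_deriv j (\<lambda>X. X $ i *\<^sub>R f X)) X
      = (if i = j then 2 *\<^sub>R partial_deriv j f X else 0) + X $ i *\<^sub>R partial_deriv j (partial_deriv j f) X" for j
  proof -
    have "partial_deriv j (partial_deriv j (\<lambda>X. X $ i *\<^sub>R f X)) X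
        = partial_deriv j (\<lambda>X. (if i = j then 1 else 0) *\<^sub>R f X + X $ i *\<^sub>R partial_deriv j f X) X"
      by (intro partial_deriv_cong[OF _ X]) (auto simp: partial_deriv_coord_scaleR[OF f])
    also have "\<dots> = (if i = j then 1 else 0) *\<^sub>R partial_deriv j f X
        + partial_deriv j (\<lambda>X. X $ i *\<^sub>R partial_deriv j f X) X"
      by (subst local_linear_operator_add[OF local_linear_operator_partial])
        (intro smooth_intros f X local_linear_operator_scaleR[OF local_linear_operator_partial] refl
          arg_cong2[where f = plus])+
    finally show ?thesis
      using partial_deriv_coord_scaleR[OF smooth_on_partial[OF f] X] by (auto simp: scaleR_2)
  qed
  then show ?thesis
    by (simp add: laplacian_def sum.distrib scaleR_right.sum)
qed

text \<open>The commutator of \<open>\<Delta>\<close> and \<open>x\<^sub>i\<close> is \<open>2 \<partial>\<^sub>i\<close>, which commutes with \<open>\<Delta>\<close>, so the commutators of the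
  individual factors of \<open>\<Delta>\<^sup>n\<^sup>+\<^sup>1\<close> add up.\<close>

lemma laplacian_funpow_coord_scaleR:
  assumes f: "smooth_on S f" and X: "X \<in> S"
  shows "(laplacian ^^ Suc n) (\<lambda>X. X $ i *\<^sub>R f X) X
    = X $ i *\<^sub>R (laplacian ^^ Suc n) f X + (2 * real (Suc n)) *\<^sub>R partial_deriv i ((laplacian ^^ n) f) X"
  using X
proof (induction n arbitrary: X)
  case 0
  then show ?case
    by (simp add: laplacian_coord_scaleR[OF f])
next
  case (Suc n)
  let ?L = "\<lambda>n. (laplacian ^^ n) f"
  have sm: "smooth_on S (?L n)" for n
    by (intro laplacian_funpow_D f)
  have "laplacian ((laplacian ^^ Suc n) (\<lambda>X. X $ i *\<^sub>R f X)) X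
      = laplacian (\<lambda>X. X $ i *\<^sub>R ?L (Suc n) X + (2 * real (Suc n)) *\<^sub>R partial_deriv i (?L n) X) X"
    using Suc by (intro laplacian_D(2))
  also have "\<dots> = laplacian (\<lambda>X. X $ i *\<^sub>R ?L (Suc n) X) X
      + laplacian (\<lambda>X. (2 * real (Suc n)) *\<^sub>R partial_deriv i (?L n) X) X"
    by (intro laplacian_D smooth_intros sm Suc.prems)
  also have "laplacian (\<lambda>X. (2 * real (Suc n)) *\<^sub>R partial_deriv i (?L n) X) X
      = (2 * real (Suc n)) *\<^sub>R laplacian (partial_deriv i (?L n)) X"
    by (intro laplacian_D smooth_intros sm Suc.prems)
  also have "laplacian (partial_deriv i (?L n)) X = partial_deriv i (?L (Suc n)) X"
    using partial_deriv_laplacian[OF sm Suc.prems] by simp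
  also have "laplacian (\<lambda>X. X $ i *\<^sub>R ?L (Suc n) X) X
      = X $ i *\<^sub>R laplacian (?L (Suc n)) X + 2 *\<^sub>R partial_deriv i (?L (Suc n)) X"
    by (rule laplacian_coord_scaleR[OF sm Suc.prems])
  finally have "(laplacian ^^ Suc (Suc n)) (\<lambda>X. X $ i *\<^sub>R f X) X
      = X $ i *\<^sub>R ?L (Suc (Suc n)) X + (2 + 2 * real (Suc n)) *\<^sub>R partial_deriv i (?L (Suc n)) X"
    by (simp only: funpow.simps comp_def scaleR_add_left add.assoc)
  then show ?case
    by (simp only: of_nat_Suc[of "Suc n"] distrib_left mult_1_right)
qed

end

locale open_clifford_domain = open_domain S
  for S :: "(real ^ 'n::{finite,linorder}) set"
begin

lemma bounded_linear_mult_left_clifford: "bounded_linear (\<lambda>x :: 'n clifford. a * x)"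
  by (intro linear_conv_bounded_linear[THEN iffD1] linearI) (simp_all add: distrib_left)

lemma bounded_linear_mult_right_clifford: "bounded_linear (\<lambda>x :: 'n clifford. x * a)"
  by (intro linear_conv_bounded_linear[THEN iffD1] linearI) (simp_all add: distrib_right)

lemma smooth_on_mult_left: "smooth_on S F \<Longrightarrow> smooth_on S (\<lambda>X. a * F X :: 'n clifford)"
  by (rule smooth_on_linear[OF bounded_linear_mult_left_clifford])

lemma smooth_on_mult_right: "smooth_on S F \<Longrightarrow> smooth_on S (\<lambda>X. F X * a :: 'n clifford)"
  by (rule smooth_on_linear[OF bounded_linear_mult_right_clifford])

lemma smooth_on_dirac: "smooth_on S F \<Longrightarrow> smooth_on S (dirac F)"
  unfolding dirac_def[abs_def] by (intro smooth_intros smooth_on_mult_left)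

lemma dirac_mult_right:
  assumes "smooth_on S F" "X \<in> S"
  shows "dirac (\<lambda>X. F X * a) X = dirac F X * a"
  unfolding dirac_def sum_distrib_right mult.assoc
  by (simp add: partial_deriv_linear[OF bounded_linear_mult_right_clifford smooth_on_differentiable[OF assms]])

lemma local_linear_operator_dirac: "local_linear_operator S dirac"
proof -
  note P = local_linear_operatorD[OF local_linear_operator_partial]
  show ?thesis
  proof (rule local_linear_operatorI)
    fix f g :: "_ \<Rightarrow> 'n clifford" and X c
    show "smooth_on S f \<Longrightarrow> smooth_on S (dirac f)"
      by (rule smooth_on_dirac)
    show "(\<And>X. X \<in> S \<Longrightarrow> f X = g X) \<Longrightarrow> X \<in> S \<Longrightarrow> dirac f X = dirac g X"
      unfolding dirac_def by (intro sum.cong refl arg_cong2[where f = times] P(2))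
    show "smooth_on S f \<Longrightarrow> smooth_on S g \<Longrightarrow> X \<in> S \<Longrightarrow>
        dirac (\<lambda>X. f X + g X) X = dirac f X + dirac g X"
      by (simp add: dirac_def P(3) sum.distrib distrib_left)
    show "smooth_on S f \<Longrightarrow> X \<in> S \<Longrightarrow> dirac (\<lambda>X. c *\<^sub>R f X) X = c *\<^sub>R dirac f X"
      by (simp add: dirac_def P(4) scaleR_right.sum)
  qed
qed

lemmas dirac_D = local_linear_operatorD[OF local_linear_operator_dirac]

lemma partial_deriv_dirac:
  assumes F: "smooth_on S F" and X: "X \<in> S"
  shows "partial_deriv i (dirac F) X = (\<Sum>j\<in>UNIV. gen j * partial_deriv i (partial_deriv j F) X)"
proof -
  have "partial_deriv i (dirac F) X = (\<Sum>j\<in>UNIV. partial_deriv i (\<lambda>X. gen j * partial_deriv j F X) X)"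
    unfolding dirac_def[abs_def]
    by (intro local_linear_operator_sum[OF local_linear_operator_partial] smooth_intros
        smooth_on_mult_left F X)
  then show ?thesis
    by (simp add: partial_deriv_linear[OF bounded_linear_mult_left_clifford
          smooth_on_differentiable[OF smooth_on_partial[OF F] X]])
qed

lemma dirac_partial_deriv:
  assumes F: "smooth_on S F" and X: "X \<in> S"
  shows "dirac (partial_deriv i F) X = partial_deriv i (dirac F) X"
  by (simp add: partial_deriv_dirac[OF F X] dirac_def partial_deriv_commute[OF open_domain X F, of i])

text \<open>The Dirac operator is a square root of \<open>- \<Delta>\<close>: the mixed terms cancel because \<open>e\<^sub>i\<close> and \<open>e\<^sub>j\<close>
  anticommute while \<open>\<partial>\<^sub>i\<close> and \<open>\<partial>\<^sub>j\<close> commute.\<close>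

lemma dirac_dirac:
  assumes F: "smooth_on S F" and X: "X \<in> S"
  shows "dirac (dirac F) X = - laplacian F X"
proof -
  let ?d = "\<lambda>i j. partial_deriv i (partial_deriv j F) X"
  have D: "dirac (dirac F) X = (\<Sum>i\<in>UNIV. \<Sum>j\<in>UNIV. gen i * gen j * ?d i j)"
    unfolding dirac_def[of "dirac F"] by (simp add: partial_deriv_dirac[OF F X] sum_distrib_left mult.assoc)
  also have "\<dots> = (\<Sum>i\<in>UNIV. \<Sum>j\<in>UNIV. gen j * gen i * ?d i j)"
    by (subst sum.swap) (simp add: partial_deriv_commute[OF open_domain X F])
  finally have "dirac (dirac F) X + dirac (dirac F) X
      = (\<Sum>i\<in>UNIV. \<Sum>j\<in>UNIV. (gen i * gen j + gen j * gen i) * ?d i j)"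
    unfolding distrib_right sum.distrib using D by simp
  also have "\<dots> = (\<Sum>i\<in>UNIV. \<Sum>j\<in>UNIV. if i = j then - 2 *\<^sub>R ?d i i else 0)"
  proof (intro sum.cong refl)
    fix i j
    show "(gen i * gen j + gen j * gen i) * ?d i j = (if i = j then - 2 *\<^sub>R ?d i i else 0)"
    proof (cases "i = j")
      case True
      then show ?thesis
        using scaleR_2[of "?d i i"] by (simp only: gen_square distrib_right) simp
    qed (simp add: gen_anticommute)
  qed
  also have "\<dots> = - 2 *\<^sub>R laplacian F X"
    by (simp add: laplacian_def scaleR_right.sum)
  finally have "2 *\<^sub>R dirac (dirac F) X = 2 *\<^sub>R (- laplacian F X)"
    by (simp add: scaleR_2)
  then show ?thesis
    by (simp del: scaleR_minus_right)
qed

lemma dirac_laplacian_funpow: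
  assumes F: "smooth_on S F" and X: "X \<in> S"
  shows "dirac ((laplacian ^^ n) F) X = (laplacian ^^ n) (dirac F) X"
proof (rule local_linear_operator_funpow_commute[OF local_linear_operator_laplacian
      local_linear_operator_dirac _ F X])
  fix F :: "_ \<Rightarrow> 'n clifford" and X
  assume F: "smooth_on S F" and X: "X \<in> S"
  have "laplacian (dirac F) X = (\<Sum>j\<in>UNIV. laplacian (\<lambda>X. gen j * partial_deriv j F X) X)"
    unfolding dirac_def[abs_def]
    by (intro local_linear_operator_sum[OF local_linear_operator_laplacian] smooth_intros
        smooth_on_mult_left F X)
  also have "\<dots> = (\<Sum>j\<in>UNIV. gen j * laplacian (partial_deriv j F) X)"
    by (intro sum.cong refl laplacian_linear bounded_linear_mult_left_clifford smooth_intros F X)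
  finally show "dirac (laplacian F) X = laplacian (dirac F) X"
    by (simp add: dirac_def[of "laplacian F"] partial_deriv_laplacian[OF F X])
qed

text \<open>
  Unlike the monogenic functions themselves, these functions allow multiplication by a coordinate, at
  the price of raising \<open>n\<close>.
\<close>

definition
  "premonogenic n F \<longleftrightarrow> smooth_on S F \<and> (\<forall>X\<in>S. dirac ((laplacian ^^ n) F) X = 0)"

lemma premonogenic_cong:
  assumes "premonogenic n F" and eq: "\<And>X. X \<in> S \<Longrightarrow> F X = G X"
  shows "premonogenic n G"
proof -
  have "dirac ((laplacian ^^ n) G) X = dirac ((laplacian ^^ n) F) X" if "X \<in> S" for X
    using that eq by (intro dirac_D(2) laplacian_funpow_D(2)) auto
  moreover have "smooth_on S G"
    using assms(1) eq unfolding premonogenic_def by (intro smooth_on_cong[of F G]) auto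
  ultimately show ?thesis
    using assms(1) by (simp add: premonogenic_def)
qed

lemma premonogenic_sum:
  assumes "\<And>a. a \<in> A \<Longrightarrow> premonogenic n (F a)"
  shows "premonogenic n (\<lambda>X. \<Sum>a\<in>A. F a X)"
proof -
  have sm: "smooth_on S (F a)" if "a \<in> A" for a
    using assms[OF that] by (simp add: premonogenic_def)
  have "dirac ((laplacian ^^ n) (\<lambda>X. \<Sum>a\<in>A. F a X)) X = 0" if X: "X \<in> S" for X
  proof -
    have "dirac ((laplacian ^^ n) (\<lambda>X. \<Sum>a\<in>A. F a X)) X = dirac (\<lambda>X. \<Sum>a\<in>A. (laplacian ^^ n) (F a) X) X"
      by (intro dirac_D(2) X local_linear_operator_sum local_linear_operator_funpow
          local_linear_operator_laplacian sm)
    also have "\<dots> = (\<Sum>a\<in>A. dirac ((laplacian ^^ n) (F a)) X)"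
      by (intro local_linear_operator_sum[OF local_linear_operator_dirac _ X] laplacian_funpow_D sm)
    also have "\<dots> = 0"
      using assms X by (intro sum.neutral) (auto simp: premonogenic_def)
    finally show ?thesis .
  qed
  then show ?thesis
    using sm by (auto simp: premonogenic_def intro: smooth_on_sum)
qed

lemma premonogenic_mult_right:
  assumes "premonogenic n F"
  shows "premonogenic n (\<lambda>X. F X * a)"
proof -
  have sm: "smooth_on S F"
    using assms by (simp add: premonogenic_def)
  have "dirac ((laplacian ^^ n) (\<lambda>X. F X * a)) X = 0" if X: "X \<in> S" for X
  proof -
    have "dirac ((laplacian ^^ n) (\<lambda>X. F X * a)) X = dirac (\<lambda>X. (laplacian ^^ n) F X * a) X"
      by (intro dirac_D(2) X laplacian_funpow_linear bounded_linear_mult_right_clifford sm)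
    also have "\<dots> = dirac ((laplacian ^^ n) F) X * a"
      by (intro dirac_mult_right X laplacian_funpow_D sm)
    also have "\<dots> = 0"
      using assms X by (simp add: premonogenic_def)
    finally show ?thesis .
  qed
  then show ?thesis
    using sm by (simp add: premonogenic_def smooth_on_mult_right)
qed

text \<open>
  Since \<open>\<Delta>\<^sup>n\<^sup>+\<^sup>1(x\<^sub>i F) = x\<^sub>i \<Delta>\<^sup>n\<^sup>+\<^sup>1 F + 2 (n + 1) \<partial>\<^sub>i \<Delta>\<^sup>n F\<close>, the Dirac operator maps this function to
  \<open>e\<^sub>i \<Delta>\<^sup>n\<^sup>+\<^sup>1 F\<close> plus terms that contain the vanishing function \<open>\<partial>\<Delta>\<^sup>n F\<close>; and \<open>\<Delta>\<^sup>n\<^sup>+\<^sup>1 F = - \<partial>(\<partial>\<Delta>\<^sup>n F)\<close>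
  vanishes as well. One further Laplacian thus pays for each coordinate factor.
\<close>

lemma premonogenic_coord_scaleR:
  assumes "premonogenic n F"
  shows "premonogenic (Suc n) (\<lambda>X. X $ i *\<^sub>R F X)"
proof -
  let ?L = "\<lambda>n. (laplacian ^^ n) F"
  have F: "smooth_on S F" and zero: "\<And>X. X \<in> S \<Longrightarrow> dirac (?L n) X = 0"
    using assms by (auto simp: premonogenic_def)
  have sm: "smooth_on S (?L n)" for n
    by (intro laplacian_funpow_D F)
  have L0: "?L (Suc n) X = 0" if "X \<in> S" for X
  proof -
    have "?L (Suc n) X = - dirac (dirac (?L n)) X"
      by (simp add: dirac_dirac[OF sm that])
    also have "dirac (dirac (?L n)) X = 0"
      using zero that by (rule local_linear_operator_zero[OF local_linear_operator_dirac])
    finally show ?thesis by simp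
  qed
  have "dirac ((laplacian ^^ Suc n) (\<lambda>X. X $ i *\<^sub>R F X)) X = 0" if X: "X \<in> S" for X
  proof -
    have "dirac ((laplacian ^^ Suc n) (\<lambda>X. X $ i *\<^sub>R F X)) X
        = dirac (\<lambda>X. (2 * real (Suc n)) *\<^sub>R partial_deriv i (?L n) X) X"
    proof (rule dirac_D(2)[OF _ X])
      fix Y assume Y: "Y \<in> S"
      show "(laplacian ^^ Suc n) (\<lambda>X. X $ i *\<^sub>R F X) Y
          = (2 * real (Suc n)) *\<^sub>R partial_deriv i ((laplacian ^^ n) F) Y"
        using laplacian_funpow_coord_scaleR[OF F Y, of n i] L0[OF Y] by simp
    qed
    also have "\<dots> = (2 * real (Suc n)) *\<^sub>R dirac (partial_deriv i (?L n)) X"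
      by (intro dirac_D smooth_intros sm X)
    also have "dirac (partial_deriv i (?L n)) X = partial_deriv i (dirac (?L n)) X"
      by (rule dirac_partial_deriv[OF sm X])
    also have "\<dots> = 0"
      using zero X by (rule local_linear_operator_zero[OF local_linear_operator_partial])
    finally show ?thesis by simp
  qed
  then show ?thesis
    by (simp add: premonogenic_def smooth_intros F)
qed

lemma premonogenic_monomial:
  assumes "premonogenic n F"
  shows "premonogenic (n + sum \<alpha> A) (\<lambda>X. (\<Prod>i\<in>A. (X $ \<iota> i) ^ \<alpha> i) *\<^sub>R F X)"
proof (induction A rule: infinite_finite_induct)
  case (insert a A)
  have "premonogenic (n + sum \<alpha> A + m) (\<lambda>X. ((X $ \<iota> a) ^ m * (\<Prod>i\<in>A. (X $ \<iota> i) ^ \<alpha> i)) *\<^sub>R F X)" for m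
  proof (induction m)
    case (Suc m)
    from premonogenic_coord_scaleR[OF Suc, of "\<iota> a"] show ?case
      by (simp add: mult.assoc)
  qed (use insert in simp)
  from this[of "\<alpha> a"] show ?case
    using insert by (simp add: add_ac)
qed (use assms in simp_all)

text \<open>The values of \<open>F\<close> need not commute with the coefficients of \<open>H\<close>; these stay on the right, where
  the Dirac operator does not see them. The map \<open>\<iota>\<close> selects the coordinates on which \<open>H\<close> depends.\<close>

lemma premonogenic_mult_homogeneous:
  assumes F: "premonogenic n F" and H: "homogeneous_polynomial R d H"
  shows "premonogenic (n + d) (\<lambda>X. F X * H (\<chi> j. X $ \<iota> j))"
proof -
  obtain c where c: "\<And>x. H x = (\<Sum>\<alpha> | (\<Sum>i\<in>UNIV. \<alpha> i) = d. (\<Prod>i\<in>UNIV. (x $ i) ^ \<alpha> i) *\<^sub>R c \<alpha>)"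
    using H unfolding homogeneous_polynomial_def by blast
  have "premonogenic (n + d) (\<lambda>X. \<Sum>\<alpha> | sum \<alpha> UNIV = d. ((\<Prod>i\<in>UNIV. (X $ \<iota> i) ^ \<alpha> i) *\<^sub>R F X) * c \<alpha>)"
    by (intro premonogenic_sum premonogenic_mult_right) (use premonogenic_monomial[OF F] in auto)
  then show ?thesis
    by (simp add: c sum_distrib_left)
qed

text \<open>The derivative is assembled from the partial derivatives, whose continuity gives continuity in
  the operator norm.\<close>

lemma smooth_on_continuously_differentiable:
  assumes "smooth_on S f"
  shows "continuously_differentiable_on f S"
proof -
  define F' where "F' = (\<lambda>X. \<Sum>j\<in>UNIV. blinfun_scaleR_left (partial_deriv j f X) o\<^sub>L Blinfun (\<lambda>h. h $ j))"
  have "blinfun_apply (F' X) = (\<lambda>h. \<Sum>j\<in>UNIV. (h $ j) *\<^sub>R partial_deriv j f X)" for X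
    by (rule ext) (simp add: F'_def blinfun.sum_left bounded_linear_Blinfun_apply bounded_linear_vec_nth)
  then have "\<forall>X\<in>S. (f has_derivative blinfun_apply (F' X)) (at X)"
    using has_derivative_partial_derivs[OF smooth_on_differentiable[OF assms]] by simp
  moreover have "continuous_on S (partial_deriv j f)" for j
    by (intro continuous_at_imp_continuous_on ballI differentiable_imp_continuous_within
        smooth_on_differentiable[OF smooth_on_partial[OF assms]])
  then have "continuous_on S F'"
    unfolding F'_def by (intro continuous_intros)
  ultimately show ?thesis
    unfolding continuously_differentiable_on_def by blast
qed

lemma premonogenic_monogenic:
  assumes "premonogenic n F"
  shows "monogenic_on ((laplacian ^^ n) F) S"
  using assms unfolding premonogenic_def monogenic_on_def
  by (auto intro!: open_domain smooth_on_continuously_differentiable laplacian_funpow_D)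

end

section \<open>Functions of two radial variables\<close>

definition block_norm :: "'n::finite set \<Rightarrow> real ^ 'n \<Rightarrow> real" where
  "block_norm I X = L2_set (\<lambda>i. X $ i) I"

lemma block_norm_power2: "(block_norm I X)\<^sup>2 = (\<Sum>i\<in>I. (X $ i)\<^sup>2)"
  by (simp add: block_norm_def L2_set_def sum_nonneg)

lemma block_norm_nonneg: "0 \<le> block_norm I X"
  by (simp add: block_norm_def)

text \<open>
  On a function \<open>g(r)\<close> of the block radius \<open>r\<close>, this is the operator \<open>r\<^sup>-\<^sup>1 d/dr\<close>, that is, the derivative with
  respect to \<open>r\<^sup>2/2\<close>. In terms of it the radial Laplacians have polynomial coefficients, and it commutes
  with them up to a shift of the dimension.
\<close>

definition radial_deriv ::
    "'n::finite set \<Rightarrow> (real ^ 'n \<Rightarrow> 'a::real_normed_vector) \<Rightarrow> real ^ 'n \<Rightarrow> 'a" where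
  "radial_deriv I f X = (1 / block_norm I X)\<^sup>2 *\<^sub>R (\<Sum>i\<in>I. X $ i *\<^sub>R partial_deriv i f X)"

text \<open>
  On functions of \<open>r\<close> this is \<open>d\<^sup>2/dr\<^sup>2 + (c - 1) r\<^sup>-\<^sup>1 d/dr\<close>, the radial part of the Laplacian in dimension \<open>c\<close>.
\<close>

definition bessel ::
    "'n::finite set \<Rightarrow> real \<Rightarrow> (real ^ 'n \<Rightarrow> 'a::real_normed_vector) \<Rightarrow> real ^ 'n \<Rightarrow> 'a" where
  "bessel I c f X =
    (block_norm I X)\<^sup>2 *\<^sub>R radial_deriv I (radial_deriv I f) X + c *\<^sub>R radial_deriv I f X"

definition bessel_pair ::
    "'n::finite set \<Rightarrow> 'n set \<Rightarrow> real \<Rightarrow> real \<Rightarrow> (real ^ 'n \<Rightarrow> 'a::real_normed_vector) \<Rightarrow>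
      real ^ 'n \<Rightarrow> 'a" where
  "bessel_pair I J c d f X = bessel I c f X + bessel J d f X"

lemma bessel_pair_swap: "bessel_pair J I d c = bessel_pair I J c d"
  by (intro ext) (simp add: bessel_pair_def add.commute)

locale block_domain = open_domain S
  for S :: "(real ^ 'n::finite) set" +
  fixes I :: "'n set"
  assumes block_norm_nonzero: "X \<in> S \<Longrightarrow> block_norm I X \<noteq> 0"
begin

lemma block_norm_pos: "X \<in> S \<Longrightarrow> block_norm I X > 0"
  using block_norm_nonzero[of X] block_norm_nonneg[of I X] by simp

text \<open>
  Dependence on the coordinates in \<open>I\<close> through the radius alone is expressed by its infinitesimal
  version, a gradient parallel to the position vector; this form passes directly to derivatives.
\<close>

definition "radial f \<longleftrightarrow> (\<forall>X\<in>S. \<forall>i\<in>I. partial_deriv i f X = X $ i *\<^sub>R radial_deriv I f X)"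

lemma radialD: "radial f \<Longrightarrow> X \<in> S \<Longrightarrow> i \<in> I \<Longrightarrow> partial_deriv i f X = X $ i *\<^sub>R radial_deriv I f X"
  by (simp add: radial_def)

lemma sum_coord_partial_deriv:
  assumes "X \<in> S"
  shows "(\<Sum>i\<in>I. X $ i *\<^sub>R partial_deriv i f X) = (block_norm I X)\<^sup>2 *\<^sub>R radial_deriv I f X"
  using block_norm_nonzero[OF assms] by (simp add: radial_deriv_def power_divide)

lemma sum_coord_square_scaleR:
  fixes v :: "'b::real_vector"
  shows "(\<Sum>i\<in>I. X $ i *\<^sub>R X $ i *\<^sub>R v) = (block_norm I X)\<^sup>2 *\<^sub>R v"
  unfolding block_norm_power2 by (simp add: scaleR_sum_left power2_eq_square)

lemma radial_deriv_eqI: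
  assumes "\<And>i. i \<in> I \<Longrightarrow> partial_deriv i f X = X $ i *\<^sub>R v" "X \<in> S"
  shows "radial_deriv I f X = v"
proof -
  have "(\<Sum>i\<in>I. X $ i *\<^sub>R partial_deriv i f X) = (\<Sum>i\<in>I. X $ i *\<^sub>R X $ i *\<^sub>R v)"
    using assms(1) by (intro sum.cong refl) (simp only:)
  then show ?thesis
    using block_norm_nonzero[OF assms(2)] unfolding radial_deriv_def sum_coord_square_scaleR
    by (simp add: power_divide)
qed

lemma radialI:
  assumes "\<And>X i. X \<in> S \<Longrightarrow> i \<in> I \<Longrightarrow> partial_deriv i f X = X $ i *\<^sub>R g X"
  shows "radial f"
  using radial_deriv_eqI[of f _ "g _", OF assms] assms unfolding radial_def by metis

lemma radial_deriv_eq_0: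
  assumes "\<And>i. i \<in> I \<Longrightarrow> partial_deriv i f X = 0"
  shows "radial_deriv I f X = 0"
  using assms by (simp add: radial_deriv_def)

lemma inverse_block_norm_derivative:
  assumes X: "X \<in> S"
  shows "((\<lambda>X. 1 / block_norm I X) has_derivative
    (\<lambda>h. - (\<Sum>i\<in>I. X $ i * h $ i) * (1 / block_norm I X) ^ 3)) (at X)"
proof -
  let ?g = "\<lambda>X :: real ^ 'n. \<Sum>i\<in>I. (X $ i)\<^sup>2"
  have g: "(?g has_derivative (\<lambda>h. \<Sum>i\<in>I. 2 * X $ i * h $ i)) (at X)"
    by (rule derivative_eq_intros bounded_linear_imp_has_derivative bounded_linear_vec_nth refl
        | simp add: mult_ac)+
  define s where "s = sqrt (?g X)"
  have r: "block_norm I Y = sqrt (?g Y)" for Y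
    by (simp add: block_norm_def L2_set_def)
  have s: "s > 0"
    using block_norm_pos[OF X] by (simp add: r s_def)
  have "((\<lambda>t. 1 / sqrt t) has_field_derivative - ((1 / s) ^ 3 / 2)) (at (?g X))"
    by (rule derivative_eq_intros refl | use s in \<open>simp add: s_def field_simps power3_eq_cube\<close>)+
  from has_derivative_compose[OF g this[unfolded has_field_derivative_def]]
  show ?thesis
    unfolding r s_def[symmetric] by (simp add: sum_distrib_right sum_distrib_left sum_negf mult_ac)
qed

lemma partial_deriv_inverse_block_norm:
  assumes X: "X \<in> S"
  shows "partial_deriv j (\<lambda>X. 1 / block_norm I X) X
    = (if j \<in> I then X $ j * - ((1 / block_norm I X) ^ 3) else 0)"
  unfolding partial_deriv_eq_frechet[OF inverse_block_norm_derivative[OF X]]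
  by (simp add: axis_def if_distrib sum.delta cong: if_cong)

lemma smooth_on_inverse_block_norm: "smooth_on S (\<lambda>X. 1 / block_norm I X)"
proof (rule smooth_onI)
  fix n
  show "differentiable_times_on n S (\<lambda>X. 1 / block_norm I X)"
  proof (induction n)
    case (Suc n)
    let ?s = "\<lambda>X. 1 / block_norm I X"
    have "differentiable_times_on n S (\<lambda>X. (if j \<in> I then - 1 else 0) * (X $ j * (?s X * (?s X * ?s X))))" (is "differentiable_times_on n S (?d j)") for j
      by (intro differentiable_times_on_bilinear[OF bounded_bilinear_mult] Suc
          smooth_on_times[OF smooth_on_const] smooth_on_times[OF smooth_on_coord])
    then have "differentiable_times_on n S (partial_deriv j ?s)" for j
      by (rule differentiable_times_on_cong[of n "?d j"])
        (simp add: partial_deriv_inverse_block_norm power3_eq_cube mult.assoc)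
    then show ?case
      using inverse_block_norm_derivative by (auto simp: differentiable_def)
  qed simp
qed

lemma smooth_on_block_norm_power2: "smooth_on S (\<lambda>X. (block_norm A X)\<^sup>2)"
  unfolding block_norm_power2 unfolding power2_eq_square by (intro smooth_intros smooth_on_mult)

lemma partial_deriv_block_norm_power2:
  "partial_deriv j (\<lambda>X. (block_norm A X)\<^sup>2) X = (if j \<in> A then 2 * X $ j else 0)"
proof -
  have *: "partial_deriv j (\<lambda>X. X $ i *\<^sub>R X $ i) X = (if i = j then 2 * X $ j else 0)" for i
    by (subst partial_deriv_bilinear[OF bounded_bilinear_scaleR])
      (auto intro!: bounded_linear_imp_differentiable bounded_linear_vec_nth simp: partial_deriv_coord)
  have "partial_deriv j (\<lambda>X. \<Sum>i\<in>A. X $ i *\<^sub>R X $ i) X = (\<Sum>i\<in>A. partial_deriv j (\<lambda>X. X $ i *\<^sub>R X $ i) X)"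
    by (intro partial_deriv_sum bounded_bilinear_differentiable[OF bounded_bilinear_scaleR]
        bounded_linear_imp_differentiable bounded_linear_vec_nth)
  then show ?thesis
    unfolding block_norm_power2 * by (simp add: power2_eq_square)
qed

lemma radial_deriv_block_norm_power2:
  assumes "X \<in> S"
  shows "radial_deriv I (\<lambda>X. (block_norm I X)\<^sup>2) X = 2"
  using assms by (intro radial_deriv_eqI) (simp_all add: partial_deriv_block_norm_power2)

lemma smooth_on_radial_deriv: "smooth_on S f \<Longrightarrow> smooth_on S (radial_deriv I f)"
  unfolding radial_deriv_def[abs_def] power2_eq_square
  by (intro smooth_intros smooth_on_mult smooth_on_inverse_block_norm)

lemma local_linear_operator_radial_deriv: "local_linear_operator S (radial_deriv I)"
proof -
  note P = local_linear_operatorD[OF local_linear_operator_partial]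
  show ?thesis
  proof (rule local_linear_operatorI)
    fix f g :: "_ \<Rightarrow> 'b::real_normed_vector" and c X
    show "smooth_on S f \<Longrightarrow> smooth_on S (radial_deriv I f)"
      by (rule smooth_on_radial_deriv)
    show "(\<And>X. X \<in> S \<Longrightarrow> f X = g X) \<Longrightarrow> X \<in> S \<Longrightarrow> radial_deriv I f X = radial_deriv I g X"
      unfolding radial_deriv_def by (intro arg_cong2[where f = scaleR] sum.cong refl P(2))
    show "smooth_on S f \<Longrightarrow> smooth_on S g \<Longrightarrow> X \<in> S \<Longrightarrow>
        radial_deriv I (\<lambda>X. f X + g X) X = radial_deriv I f X + radial_deriv I g X"
      by (simp add: radial_deriv_def P(3) scaleR_add_right sum.distrib)
    show "smooth_on S f \<Longrightarrow> X \<in> S \<Longrightarrow> radial_deriv I (\<lambda>X. c *\<^sub>R f X) X = c *\<^sub>R radial_deriv I f X"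
      by (simp add: radial_deriv_def P(4) scaleR_right.sum mult_ac)
  qed
qed

lemmas radial_deriv_D = local_linear_operatorD[OF local_linear_operator_radial_deriv]

lemma radial_deriv_scaleR:
  assumes "smooth_on S h" "smooth_on S f" "X \<in> S"
  shows "radial_deriv I (\<lambda>X. h X *\<^sub>R f X) X = radial_deriv I h X *\<^sub>R f X + h X *\<^sub>R radial_deriv I f X"
  by (simp add: radial_deriv_def partial_deriv_scaleR_smooth[OF assms] scaleR_add_right sum.distrib
      scaleR_sum_left scaleR_sum_right sum_distrib_left mult_ac)

lemma radial_deriv_scaleR_const:
  assumes "smooth_on S h" "smooth_on S f" "X \<in> S" "\<And>i. i \<in> I \<Longrightarrow> partial_deriv i h X = 0"
  shows "radial_deriv I (\<lambda>X. h X *\<^sub>R f X) X = h X *\<^sub>R radial_deriv I f X"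
  using radial_deriv_scaleR[OF assms(1-3)] radial_deriv_eq_0[of h X] assms(4) by simp

lemma radial_add:
  assumes "radial f" "radial g" "smooth_on S f" "smooth_on S g"
  shows "radial (\<lambda>X. f X + g X)"
  by (rule radialI[of _ "\<lambda>X. radial_deriv I f X + radial_deriv I g X"])
    (use assms in \<open>simp add: partial_deriv_add smooth_on_differentiable radialD scaleR_add_right\<close>)

lemma radial_scaleR:
  assumes "radial h" "radial f" "smooth_on S h" "smooth_on S f"
  shows "radial (\<lambda>X. h X *\<^sub>R f X)"
  by (rule radialI[of _ "\<lambda>X. radial_deriv I h X *\<^sub>R f X + h X *\<^sub>R radial_deriv I f X"])
    (use assms in \<open>simp add: partial_deriv_scaleR_smooth radialD scaleR_add_right mult_ac\<close>)

lemma radial_const: "radial (\<lambda>X. c)"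
  by (rule radialI[of _ "\<lambda>X. 0"]) simp

lemma radial_block_norm_power2: "radial (\<lambda>X. (block_norm I X)\<^sup>2)"
  by (rule radialI[of _ "\<lambda>X. 2"]) (simp add: partial_deriv_block_norm_power2)

text \<open>
  Differentiating \<open>\<partial>\<^sub>j f = x\<^sub>j T f\<close> once more, the symmetry of second derivatives gives
  \<open>x\<^sub>j \<partial>\<^sub>i T f = x\<^sub>i \<partial>\<^sub>j T f\<close>, so that the gradient of \<open>T f\<close> is again parallel to the position vector.
\<close>

lemma radial_radial_deriv:
  assumes f: "smooth_on S f" and rad: "radial f"
  shows "radial (radial_deriv I f)"
proof (rule radialI)
  fix X i assume X: "X \<in> S" and i: "i \<in> I"
  let ?T = "radial_deriv I f"
  have T: "smooth_on S ?T"
    using f by (rule smooth_on_radial_deriv)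
  have pp: "partial_deriv a (partial_deriv b f) X = (if b = a then ?T X else 0) + X $ b *\<^sub>R partial_deriv a ?T X"
    if "b \<in> I" for a b
  proof -
    have "partial_deriv a (partial_deriv b f) X = partial_deriv a (\<lambda>X. X $ b *\<^sub>R ?T X) X"
      by (rule partial_deriv_cong[OF radialD[OF rad _ that] X])
    then show ?thesis
      by (simp add: partial_deriv_coord_scaleR[OF T X])
  qed
  have swap: "X $ j *\<^sub>R partial_deriv i ?T X = X $ i *\<^sub>R partial_deriv j ?T X" if j: "j \<in> I" for j
    using pp[OF i, of j] pp[OF j, of i] partial_deriv_commute[OF open_domain X f, of i j]
    by (cases "i = j") auto
  have "(block_norm I X)\<^sup>2 *\<^sub>R partial_deriv i ?T X = (\<Sum>j\<in>I. X $ j *\<^sub>R X $ i *\<^sub>R partial_deriv j ?T X)"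
    unfolding sum_coord_square_scaleR[symmetric] by (intro sum.cong refl arg_cong2[where f = scaleR] swap)
  also have "\<dots> = X $ i *\<^sub>R (\<Sum>j\<in>I. X $ j *\<^sub>R partial_deriv j ?T X)"
    by (simp add: scaleR_right.sum mult_ac)
  also have "\<dots> = (block_norm I X)\<^sup>2 *\<^sub>R X $ i *\<^sub>R radial_deriv I ?T X"
    by (simp add: sum_coord_partial_deriv[OF X])
  finally show "partial_deriv i ?T X = X $ i *\<^sub>R radial_deriv I ?T X"
    unfolding scaleR_cancel_left using block_norm_nonzero[OF X] by simp
qed

lemma partial_deriv_radial_deriv_outside:
  assumes f: "smooth_on S f" and X: "X \<in> S" and j: "j \<notin> I"
  shows "partial_deriv j (radial_deriv I f) X = radial_deriv I (partial_deriv j f) X"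
proof -
  let ?a = "\<lambda>X. (1 / block_norm I X)\<^sup>2" and ?E = "\<lambda>X. \<Sum>i\<in>I. X $ i *\<^sub>R partial_deriv i f X"
  have a: "smooth_on S ?a"
    unfolding power2_eq_square by (intro smooth_on_mult smooth_on_inverse_block_norm)
  have "partial_deriv j (\<lambda>X. (1 / block_norm I X) *\<^sub>R (1 / block_norm I X)) X = 0"
    using j by (subst partial_deriv_scaleR_smooth[OF smooth_on_inverse_block_norm smooth_on_inverse_block_norm X])
      (simp add: partial_deriv_inverse_block_norm[OF X])
  then have pa: "partial_deriv j ?a X = 0"
    by (simp add: power2_eq_square)
  have "partial_deriv j ?E X = (\<Sum>i\<in>I. partial_deriv j (\<lambda>X. X $ i *\<^sub>R partial_deriv i f X) X)"
    by (intro local_linear_operator_sum[OF local_linear_operator_partial] smooth_intros f X)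
  also have "\<dots> = (\<Sum>i\<in>I. X $ i *\<^sub>R partial_deriv i (partial_deriv j f) X)"
    using j by (intro sum.cong refl)
      (auto simp: partial_deriv_coord_scaleR[OF smooth_on_partial[OF f] X] partial_deriv_commute[OF open_domain X f, of j])
  finally have pE: "partial_deriv j ?E X = (\<Sum>i\<in>I. X $ i *\<^sub>R partial_deriv i (partial_deriv j f) X)" .
  have E: "smooth_on S ?E"
    by (intro smooth_intros f)
  show ?thesis
    unfolding radial_deriv_def[of I f, abs_def] partial_deriv_scaleR_smooth[OF a E X] pa pE
    by (simp add: radial_deriv_def)
qed

lemma smooth_on_bessel: "smooth_on S f \<Longrightarrow> smooth_on S (bessel I c f)"
  unfolding bessel_def[abs_def]
  by (intro smooth_intros smooth_on_block_norm_power2 smooth_on_radial_deriv)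

lemma radial_bessel:
  assumes "smooth_on S f" "radial f"
  shows "radial (bessel I c f)"
  unfolding bessel_def[abs_def]
  by (intro radial_add radial_scaleR radial_const radial_block_norm_power2 radial_radial_deriv assms
      smooth_intros smooth_on_block_norm_power2 smooth_on_radial_deriv)

lemma bessel_add_const: "bessel I (c + c') f X = bessel I c f X + c' *\<^sub>R radial_deriv I f X"
  by (simp add: bessel_def scaleR_add_left)

lemma local_linear_operator_bessel: "local_linear_operator S (bessel I c)"
proof -
  note P = radial_deriv_D
  have P2: "local_linear_operator S (\<lambda>f. radial_deriv I (radial_deriv I f))"
    using local_linear_operator_funpow[OF local_linear_operator_radial_deriv, of 2]
    by (simp add: numeral_2_eq_2 comp_def)
  note P2 = local_linear_operatorD[OF P2]
  show ?thesis
  proof (rule local_linear_operatorI)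
    fix f g :: "_ \<Rightarrow> 'b::real_normed_vector" and a X
    show "smooth_on S f \<Longrightarrow> smooth_on S (bessel I c f)"
      by (rule smooth_on_bessel)
    show "(\<And>X. X \<in> S \<Longrightarrow> f X = g X) \<Longrightarrow> X \<in> S \<Longrightarrow> bessel I c f X = bessel I c g X"
      unfolding bessel_def by (intro arg_cong2[where f = scaleR] arg_cong2[where f = plus] refl P(2) P2(2))
    show "smooth_on S f \<Longrightarrow> smooth_on S g \<Longrightarrow> X \<in> S \<Longrightarrow>
        bessel I c (\<lambda>X. f X + g X) X = bessel I c f X + bessel I c g X"
      by (simp add: bessel_def P(3) P2(3) scaleR_add_right)
    show "smooth_on S f \<Longrightarrow> X \<in> S \<Longrightarrow> bessel I c (\<lambda>X. a *\<^sub>R f X) X = a *\<^sub>R bessel I c f X"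
      by (simp add: bessel_def P(4) P2(4) scaleR_add_right mult_ac)
  qed
qed

text \<open>
  The radial derivative \<open>T\<close> raises the dimension by two because \<open>T(r\<^sup>2) = 2\<close> adds \<open>2 T\<^sup>2 f\<close> when \<open>T\<close> is
  moved past the coefficient \<open>r\<^sup>2\<close>.
\<close>

lemma radial_deriv_bessel:
  assumes f: "smooth_on S f" and X: "X \<in> S"
  shows "radial_deriv I (bessel I c f) X = bessel I (c + 2) (radial_deriv I f) X"
proof -
  let ?T = "radial_deriv I"
  have sm: "smooth_on S (?T f)" "smooth_on S (?T (?T f))"
    by (intro smooth_on_radial_deriv f)+
  have "?T (bessel I c f) X
      = ?T (\<lambda>X. (block_norm I X)\<^sup>2 *\<^sub>R ?T (?T f) X) X + ?T (\<lambda>X. c *\<^sub>R ?T f X) X"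
    unfolding bessel_def[abs_def]
    by (intro radial_deriv_D smooth_intros smooth_on_block_norm_power2 sm X)
  also have "\<dots> = 2 *\<^sub>R ?T (?T f) X + (block_norm I X)\<^sup>2 *\<^sub>R ?T (?T (?T f)) X + c *\<^sub>R ?T (?T f) X"
    by (simp add: radial_deriv_scaleR[OF smooth_on_block_norm_power2 sm(2) X]
        radial_deriv_block_norm_power2[OF X] radial_deriv_D(4)[OF sm(1) X])
  finally show ?thesis
    by (simp add: bessel_def scaleR_add_left)
qed

lemma sum_second_partial_derivs:
  assumes f: "smooth_on S f" "radial f" and X: "X \<in> S"
  shows "(\<Sum>i\<in>I. partial_deriv i (partial_deriv i f) X) = bessel I (real (card I)) f X"
proof -
  have "(\<Sum>i\<in>I. partial_deriv i (partial_deriv i f) X)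
      = (\<Sum>i\<in>I. radial_deriv I f X + X $ i *\<^sub>R partial_deriv i (radial_deriv I f) X)"
  proof (rule sum.cong[OF refl])
    fix i assume i: "i \<in> I"
    have "partial_deriv i (partial_deriv i f) X = partial_deriv i (\<lambda>X. X $ i *\<^sub>R radial_deriv I f X) X"
      by (rule partial_deriv_cong[OF radialD[OF f(2) _ i] X])
    then show "partial_deriv i (partial_deriv i f) X
        = radial_deriv I f X + X $ i *\<^sub>R partial_deriv i (radial_deriv I f) X"
      by (simp add: partial_deriv_coord_scaleR[OF smooth_on_radial_deriv[OF f(1)] X])
  qed
  then show ?thesis
    by (simp add: sum.distrib sum_coord_partial_deriv[OF X] bessel_def sum_constant_scaleR)
qed

end

locale block_pair = open_domain S + I: block_domain S I + J: block_domain S J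
  for S :: "(real ^ 'n::finite) set" and I J +
  assumes disjoint: "I \<inter> J = {}"
begin

lemma swap: "block_pair S J I"
  using disjoint by unfold_locales auto

text \<open>The coefficients of each radial derivative are constant in the coordinates of the other block.\<close>

lemma radial_deriv_commute:
  assumes f: "smooth_on S f" and X: "X \<in> S"
  shows "radial_deriv I (radial_deriv J f) X = radial_deriv J (radial_deriv I f) X"
proof -
  let ?a = "\<lambda>X. (1 / block_norm I X)\<^sup>2"
  have a: "smooth_on S ?a"
    unfolding power2_eq_square by (intro smooth_on_mult I.smooth_on_inverse_block_norm)
  have pa: "partial_deriv j ?a X = 0" if j: "j \<in> J" for j
  proof -
    have "j \<notin> I"
      using j disjoint by auto
    then have "partial_deriv j (\<lambda>X. (1 / block_norm I X) *\<^sub>R (1 / block_norm I X)) X = 0"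
      by (subst partial_deriv_scaleR_smooth[OF I.smooth_on_inverse_block_norm I.smooth_on_inverse_block_norm X])
        (simp add: I.partial_deriv_inverse_block_norm[OF X])
    then show ?thesis
      by (simp add: power2_eq_square)
  qed
  have E: "radial_deriv J (\<lambda>X. X $ i *\<^sub>R partial_deriv i f X) X = X $ i *\<^sub>R partial_deriv i (radial_deriv J f) X"
    if i: "i \<in> I" for i
  proof -
    have "i \<notin> J"
      using i disjoint by auto
    then have "radial_deriv J (\<lambda>X. X $ i *\<^sub>R partial_deriv i f X) X = X $ i *\<^sub>R radial_deriv J (partial_deriv i f) X"
      by (intro J.radial_deriv_scaleR_const smooth_intros f X) (auto simp: partial_deriv_coord)
    then show ?thesis
      by (simp add: J.partial_deriv_radial_deriv_outside[OF f X \<open>i \<notin> J\<close>])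
  qed
  have "radial_deriv J (radial_deriv I f) X
      = ?a X *\<^sub>R radial_deriv J (\<lambda>X. \<Sum>i\<in>I. X $ i *\<^sub>R partial_deriv i f X) X"
    unfolding radial_deriv_def[of I f, abs_def]
    by (intro J.radial_deriv_scaleR_const a pa smooth_intros f X)
  also have "radial_deriv J (\<lambda>X. \<Sum>i\<in>I. X $ i *\<^sub>R partial_deriv i f X) X
      = (\<Sum>i\<in>I. radial_deriv J (\<lambda>X. X $ i *\<^sub>R partial_deriv i f X) X)"
    by (intro local_linear_operator_sum[OF J.local_linear_operator_radial_deriv] smooth_intros f X)
  also have "\<dots> = (\<Sum>i\<in>I. X $ i *\<^sub>R partial_deriv i (radial_deriv J f) X)"
    by (intro sum.cong refl E)
  finally show ?thesis
    unfolding radial_deriv_def[of I "radial_deriv J f"] ..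
qed

lemma radial_radial_deriv_other:
  assumes f: "smooth_on S f" and rad: "I.radial f"
  shows "I.radial (radial_deriv J f)"
proof (rule I.radialI)
  fix X i assume X: "X \<in> S" and i: "i \<in> I"
  have "i \<notin> J"
    using i disjoint by auto
  then have "partial_deriv i (radial_deriv J f) X = radial_deriv J (partial_deriv i f) X"
    by (rule J.partial_deriv_radial_deriv_outside[OF f X])
  also have "\<dots> = radial_deriv J (\<lambda>X. X $ i *\<^sub>R radial_deriv I f X) X"
    by (intro J.radial_deriv_D(2) X I.radialD[OF rad _ i])
  also have "\<dots> = X $ i *\<^sub>R radial_deriv J (radial_deriv I f) X"
    using \<open>i \<notin> J\<close> by (intro J.radial_deriv_scaleR_const smooth_intros I.smooth_on_radial_deriv f X)
      (auto simp: partial_deriv_coord)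
  finally show "partial_deriv i (radial_deriv J f) X = X $ i *\<^sub>R radial_deriv J (radial_deriv I f) X" .
qed

lemma radial_block_norm_power2_other: "I.radial (\<lambda>X. (block_norm J X)\<^sup>2)"
  using disjoint by (intro I.radialI[of _ "\<lambda>X. 0"]) (auto simp: I.partial_deriv_block_norm_power2)

lemma radial_bessel_other:
  assumes "smooth_on S f" "I.radial f"
  shows "I.radial (bessel J d f)"
  unfolding bessel_def[abs_def]
  by (intro I.radial_add I.radial_scaleR I.radial_const radial_block_norm_power2_other
      radial_radial_deriv_other assms smooth_intros I.smooth_on_block_norm_power2 J.smooth_on_radial_deriv)

lemma radial_deriv_bessel_other:
  assumes f: "smooth_on S f" and X: "X \<in> S"
  shows "radial_deriv I (bessel J d f) X = bessel J d (radial_deriv I f) X"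
proof -
  let ?T = "radial_deriv I" and ?U = "radial_deriv J"
  have sm: "smooth_on S (?U f)" "smooth_on S (?U (?U f))"
    by (intro J.smooth_on_radial_deriv f)+
  have comm2: "?T (?U (?U f)) X = ?U (?U (?T f)) X"
    using radial_deriv_commute[OF sm(1) X] J.radial_deriv_D(2)[OF radial_deriv_commute[OF f] X] by simp
  have "?T (bessel J d f) X
      = ?T (\<lambda>X. (block_norm J X)\<^sup>2 *\<^sub>R ?U (?U f) X) X + ?T (\<lambda>X. d *\<^sub>R ?U f X) X"
    unfolding bessel_def[abs_def]
    by (intro I.radial_deriv_D smooth_intros I.smooth_on_block_norm_power2 sm X)
  also have "?T (\<lambda>X. (block_norm J X)\<^sup>2 *\<^sub>R ?U (?U f) X) X = (block_norm J X)\<^sup>2 *\<^sub>R ?T (?U (?U f)) X"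
    using disjoint by (intro I.radial_deriv_scaleR_const I.smooth_on_block_norm_power2 sm X)
      (auto simp: I.partial_deriv_block_norm_power2)
  also have "?T (\<lambda>X. d *\<^sub>R ?U f X) X = d *\<^sub>R ?T (?U f) X"
    by (rule I.radial_deriv_D(4)[OF sm(1) X])
  finally show ?thesis
    by (simp add: bessel_def[abs_def] comm2 radial_deriv_commute[OF f X])
qed

lemma local_linear_operator_bessel_pair: "local_linear_operator S (bessel_pair I J c d)"
proof -
  note DI = local_linear_operatorD[OF I.local_linear_operator_bessel]
  note DJ = local_linear_operatorD[OF J.local_linear_operator_bessel]
  show ?thesis
  proof (rule local_linear_operatorI)
    fix f g :: "_ \<Rightarrow> 'b::real_normed_vector" and a X
    show "smooth_on S f \<Longrightarrow> smooth_on S (bessel_pair I J c d f)"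
      unfolding bessel_pair_def[abs_def] by (intro smooth_intros I.smooth_on_bessel J.smooth_on_bessel)
    show "(\<And>X. X \<in> S \<Longrightarrow> f X = g X) \<Longrightarrow> X \<in> S \<Longrightarrow> bessel_pair I J c d f X = bessel_pair I J c d g X"
      unfolding bessel_pair_def by (intro arg_cong2[where f = plus] DI(2) DJ(2))
    show "smooth_on S f \<Longrightarrow> smooth_on S g \<Longrightarrow> X \<in> S \<Longrightarrow>
        bessel_pair I J c d (\<lambda>X. f X + g X) X = bessel_pair I J c d f X + bessel_pair I J c d g X"
      by (simp add: bessel_pair_def DI(3) DJ(3))
    show "smooth_on S f \<Longrightarrow> X \<in> S \<Longrightarrow>
        bessel_pair I J c d (\<lambda>X. a *\<^sub>R f X) X = a *\<^sub>R bessel_pair I J c d f X"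
      by (simp add: bessel_pair_def DI(4) DJ(4) scaleR_add_right)
  qed
qed

lemmas bessel_pair_D = local_linear_operatorD[OF local_linear_operator_bessel_pair]

lemmas bessel_pair_funpow_D =
  local_linear_operatorD[OF local_linear_operator_funpow[OF local_linear_operator_bessel_pair]]

lemma bessel_pair_radial_deriv:
  assumes g: "smooth_on S g" and zero: "\<And>X. X \<in> S \<Longrightarrow> bessel_pair I J c d g X = 0" and X: "X \<in> S"
  shows "bessel_pair I J (c + 2) d (radial_deriv I g) X = 0"
proof -
  have "bessel_pair I J (c + 2) d (radial_deriv I g) X = radial_deriv I (bessel_pair I J c d g) X"
    unfolding bessel_pair_def[abs_def]
    using I.radial_deriv_D(3)[OF I.smooth_on_bessel[OF g] J.smooth_on_bessel[OF g] X]
    by (simp add: I.radial_deriv_bessel[OF g X] radial_deriv_bessel_other[OF g X])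
  also have "\<dots> = 0"
    using zero X by (rule local_linear_operator_zero[OF I.local_linear_operator_radial_deriv])
  finally show ?thesis .
qed

text \<open>
  Write \<open>\<Delta>\<^sub>c\<^sub>d\<close> for \<open>bessel_pair I J c d\<close>. If \<open>\<Delta>\<^sub>c\<^sub>d g = 0\<close>, then \<open>\<Delta>\<^sub>c\<^sub>+\<^sub>2\<^sub>i\<^sub>,\<^sub>d\<^sub>+\<^sub>2\<^sub>j g\<close> is a combination of the
  two radial derivatives of \<open>g\<close> with coefficients \<open>2 i\<close> and \<open>2 j\<close>. These are annihilated by \<open>\<Delta>\<^sub>c\<^sub>+\<^sub>2\<^sub>,\<^sub>d\<close> and
  \<open>\<Delta>\<^sub>c\<^sub>,\<^sub>d\<^sub>+\<^sub>2\<close>, so each application of the operator lowers \<open>i + j\<close> by one.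
\<close>

lemma bessel_pair_funpow_eq_0:
  assumes "smooth_on S g" and "\<And>X. X \<in> S \<Longrightarrow> bessel_pair I J c d g X = 0" and "X \<in> S"
  shows "(bessel_pair I J (c + 2 * real i) (d + 2 * real j) ^^ Suc (i + j)) g X = 0"
  using assms
proof (induction "i + j" arbitrary: i j c d g X)
  case 0
  then show ?case
    by simp
next
  case (Suc n)
  interpret sw: block_pair S J I
    by (rule swap)
  let ?B = "bessel_pair I J (c + 2 * real i) (d + 2 * real j)"
  let ?T = "radial_deriv I g" and ?U = "radial_deriv J g"
  have T: "smooth_on S ?T" and U: "smooth_on S ?U"
    using Suc.prems(1) by (rule I.smooth_on_radial_deriv J.smooth_on_radial_deriv)+
  have "(?B ^^ Suc (Suc n)) g X = (?B ^^ Suc n) (?B g) X"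
    by (simp only: funpow_Suc_right comp_def)
  also have "\<dots> = (?B ^^ Suc n) (\<lambda>X. (2 * real i) *\<^sub>R ?T X + (2 * real j) *\<^sub>R ?U X) X"
  proof (rule bessel_pair_funpow_D(2)[OF _ Suc.prems(3)])
    fix Y assume "Y \<in> S"
    then show "?B g Y = (2 * real i) *\<^sub>R ?T Y + (2 * real j) *\<^sub>R ?U Y"
      using Suc.prems(2)[of Y] unfolding bessel_pair_def I.bessel_add_const J.bessel_add_const
      by (simp add: algebra_simps)
  qed
  also have "\<dots> = (?B ^^ Suc n) (\<lambda>X. (2 * real i) *\<^sub>R ?T X) X + (?B ^^ Suc n) (\<lambda>X. (2 * real j) *\<^sub>R ?U X) X"
    by (intro bessel_pair_funpow_D smooth_intros T U Suc.prems)
  also have "\<dots> = (2 * real i) *\<^sub>R (?B ^^ Suc n) ?T X + (2 * real j) *\<^sub>R (?B ^^ Suc n) ?U X"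
    by (simp only: bessel_pair_funpow_D(4)[OF T Suc.prems(3)] bessel_pair_funpow_D(4)[OF U Suc.prems(3)])
  also have "(2 * real i) *\<^sub>R (?B ^^ Suc n) ?T X = 0"
  proof (cases i)
    case (Suc i')
    have "bessel_pair I J (c + 2) d ?T Y = 0" if "Y \<in> S" for Y
      using bessel_pair_radial_deriv[OF Suc.prems(1,2) that] .
    from Suc.hyps(1)[of i' j, OF _ T this Suc.prems(3)] Suc.hyps(2) Suc show ?thesis
      by (simp add: algebra_simps)
  qed simp
  also have "(2 * real j) *\<^sub>R (?B ^^ Suc n) ?U X = 0"
  proof (cases j)
    case (Suc j')
    have "bessel_pair I J c (d + 2) ?U Y = 0" if "Y \<in> S" for Y
      using sw.bessel_pair_radial_deriv[of g d c, OF Suc.prems(1) _ that] Suc.prems(2)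
      by (simp add: bessel_pair_def add.commute)
    from Suc.hyps(1)[of i j', OF _ U this Suc.prems(3)] Suc.hyps(2) Suc show ?thesis
      by (simp add: algebra_simps)
  qed simp
  finally show ?case
    using Suc.hyps(2) by simp
qed

definition "biaxial f \<longleftrightarrow> smooth_on S f \<and> I.radial f \<and> J.radial f"

lemma biaxial_swap: "block_pair.biaxial S J I f \<longleftrightarrow> biaxial f"
  by (auto simp: biaxial_def block_pair.biaxial_def[OF swap])

lemma biaxial_bessel_pair:
  assumes "biaxial f"
  shows "biaxial (bessel_pair I J c d f)"
proof -
  interpret sw: block_pair S J I
    by (rule swap)
  have f: "smooth_on S f" "I.radial f" "J.radial f"
    using assms by (simp_all add: biaxial_def)
  have sm: "smooth_on S (bessel I c f)" "smooth_on S (bessel J d f)"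
    using f(1) by (rule I.smooth_on_bessel J.smooth_on_bessel)+
  have "I.radial (bessel_pair I J c d f)"
    unfolding bessel_pair_def[abs_def] by (intro I.radial_add I.radial_bessel radial_bessel_other f sm)
  moreover have "J.radial (bessel_pair I J c d f)"
    unfolding bessel_pair_def[abs_def] by (intro J.radial_add J.radial_bessel sw.radial_bessel_other f sm)
  ultimately show ?thesis
    using f(1) by (simp add: biaxial_def bessel_pair_D(1))
qed

lemma biaxial_bessel_pair_funpow: "biaxial f \<Longrightarrow> biaxial ((bessel_pair I J c d ^^ n) f)"
  by (induction n) (simp_all add: biaxial_bessel_pair)

lemma biaxial_scaleR: "biaxial h \<Longrightarrow> biaxial f \<Longrightarrow> biaxial (\<lambda>X. h X *\<^sub>R f X)"
  by (simp add: biaxial_def I.radial_scaleR J.radial_scaleR smooth_on_scaleR)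

end

locale biaxial_domain = block_pair S I J
  for S :: "(real ^ 'n::finite) set" and I J +
  assumes cover: "I \<union> J = UNIV"
begin

lemma swap_biaxial: "biaxial_domain S J I"
  using cover disjoint by unfold_locales auto

lemma laplacian_biaxial:
  assumes "biaxial f" "X \<in> S"
  shows "laplacian f X = bessel_pair I J (real (card I)) (real (card J)) f X"
proof -
  have "laplacian f X = (\<Sum>i\<in>I. partial_deriv i (partial_deriv i f) X) + (\<Sum>i\<in>J. partial_deriv i (partial_deriv i f) X)"
    unfolding laplacian_def using disjoint by (subst sum.union_disjoint[symmetric]) (auto simp: cover)
  then show ?thesis
    using assms by (simp add: biaxial_def I.sum_second_partial_derivs J.sum_second_partial_derivs bessel_pair_def)
qed

lemma laplacian_funpow_biaxial:
  assumes f: "biaxial f" and X: "X \<in> S"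
  shows "(laplacian ^^ n) f X = (bessel_pair I J (real (card I)) (real (card J)) ^^ n) f X"
  using X
proof (induction n arbitrary: X)
  case (Suc n)
  let ?B = "bessel_pair I J (real (card I)) (real (card J))"
  have "laplacian ((laplacian ^^ n) f) X = laplacian ((?B ^^ n) f) X"
    using Suc by (intro laplacian_D(2))
  then show ?case
    by (simp add: laplacian_biaxial[OF biaxial_bessel_pair_funpow[OF f] Suc.prems])
qed simp

text \<open>
  The commutator term \<open>2 \<partial>\<^sub>i f = 2 x\<^sub>i T f\<close> is divisible by \<open>x\<^sub>i\<close> and raises the dimension of the block of
  \<open>i\<close> by two.
\<close>

lemma laplacian_funpow_coord_biaxial:
  assumes f: "biaxial f" and i: "i \<in> I" and X: "X \<in> S"
  shows "(laplacian ^^ n) (\<lambda>X. X $ i *\<^sub>R f X) X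
    = X $ i *\<^sub>R (bessel_pair I J (real (card I) + 2) (real (card J)) ^^ n) f X"
  using X
proof (induction n arbitrary: X)
  case (Suc n)
  let ?B = "bessel_pair I J (real (card I) + 2) (real (card J))"
  let ?g = "(?B ^^ n) f"
  have g: "biaxial ?g"
    by (rule biaxial_bessel_pair_funpow[OF f])
  then have sm: "smooth_on S ?g" and rad: "I.radial ?g"
    by (simp_all add: biaxial_def)
  have "laplacian ((laplacian ^^ n) (\<lambda>X. X $ i *\<^sub>R f X)) X = laplacian (\<lambda>X. X $ i *\<^sub>R ?g X) X"
    using Suc by (intro laplacian_D(2))
  also have "\<dots> = X $ i *\<^sub>R laplacian ?g X + 2 *\<^sub>R partial_deriv i ?g X"
    by (rule laplacian_coord_scaleR[OF sm Suc.prems])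
  also have "\<dots> = X $ i *\<^sub>R ?B ?g X"
    by (simp add: laplacian_biaxial[OF g Suc.prems] I.radialD[OF rad Suc.prems i] bessel_pair_def
        I.bessel_add_const scaleR_add_right mult_ac)
  finally show ?case
    by simp
qed simp

end

section \<open>Functions built from a holomorphic function of the two radii\<close>

context block_domain
begin

lemma smooth_on_block_norm: "smooth_on S (block_norm I)"
  by (rule smooth_on_cong[OF smooth_on_scaleR[OF smooth_on_block_norm_power2[of I] smooth_on_inverse_block_norm]])
    (simp add: power2_eq_square block_norm_nonzero)

lemma partial_deriv_block_norm:
  assumes X: "X \<in> S"
  shows "partial_deriv j (block_norm I) X = (if j \<in> I then X $ j * (1 / block_norm I X) else 0)"
proof -
  have "partial_deriv j (block_norm I) X
      = partial_deriv j (\<lambda>X. (block_norm I X)\<^sup>2 *\<^sub>R (1 / block_norm I X)) X"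
    by (rule partial_deriv_cong[OF _ X]) (simp add: power2_eq_square)
  then show ?thesis
    unfolding partial_deriv_scaleR_smooth[OF smooth_on_block_norm_power2 smooth_on_inverse_block_norm X]
      partial_deriv_block_norm_power2 partial_deriv_inverse_block_norm[OF X]
    using block_norm_nonzero[OF X]
    by (cases "j \<in> I") (simp_all add: power2_eq_square power3_eq_cube field_simps)
qed

lemma radial_deriv_inverse_block_norm:
  assumes "X \<in> S"
  shows "radial_deriv I (\<lambda>X. 1 / block_norm I X) X = - ((1 / block_norm I X) ^ 3)"
  using assms by (intro radial_deriv_eqI) (simp_all add: partial_deriv_inverse_block_norm)

lemma radial_deriv_block_norm:
  assumes "X \<in> S"
  shows "radial_deriv I (block_norm I) X = 1 / block_norm I X"
  using assms by (intro radial_deriv_eqI) (simp_all add: partial_deriv_block_norm)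

lemma radial_deriv_inverse_block_norm_scaleR:
  assumes "smooth_on S f" "X \<in> S"
  shows "radial_deriv I (\<lambda>X. (1 / block_norm I X) *\<^sub>R f X) X
    = (1 / block_norm I X) *\<^sub>R radial_deriv I f X - (1 / block_norm I X) ^ 3 *\<^sub>R f X"
  by (simp add: radial_deriv_scaleR[OF smooth_on_inverse_block_norm assms]
      radial_deriv_inverse_block_norm[OF assms(2)])

text \<open>The hypotheses say that \<open>G\<close> and \<open>H\<close> are the first and second derivatives of \<open>F\<close> with respect to \<open>r\<close>;
  in dimension one the radial Laplacian is the second derivative.\<close>

lemma bessel_1:
  assumes G: "smooth_on S G"
    and F': "\<And>X. X \<in> S \<Longrightarrow> radial_deriv I F X = (1 / block_norm I X) *\<^sub>R G X"
    and G': "\<And>X. X \<in> S \<Longrightarrow> radial_deriv I G X = (1 / block_norm I X) *\<^sub>R H X"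
    and X: "X \<in> S"
  shows "bessel I 1 F X = H X"
proof -
  have "radial_deriv I (radial_deriv I F) X = radial_deriv I (\<lambda>X. (1 / block_norm I X) *\<^sub>R G X) X"
    using F' X by (rule radial_deriv_D(2))
  also have "\<dots> = (1 / block_norm I X)\<^sup>2 *\<^sub>R H X - (1 / block_norm I X) ^ 3 *\<^sub>R G X"
    by (simp add: radial_deriv_inverse_block_norm_scaleR[OF G X] G'[OF X] power2_eq_square)
  finally show ?thesis
    using block_norm_nonzero[OF X]
    by (simp add: bessel_def F'[OF X] scaleR_diff_right power2_eq_square power3_eq_cube)
qed

text \<open>This is the classical identity \<open>\<Delta>(f/r) = f''/r\<close> for radial functions in dimension three.\<close>

lemma bessel_3_inverse_block_norm:
  assumes f: "smooth_on S f" and X: "X \<in> S"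
  shows "bessel I 3 (\<lambda>X. (1 / block_norm I X) *\<^sub>R f X) X = (1 / block_norm I X) *\<^sub>R bessel I 1 f X"
proof -
  let ?s = "\<lambda>X. 1 / block_norm I X" and ?T = "radial_deriv I"
  let ?g = "\<lambda>X. ?s X *\<^sub>R f X"
  have Tf: "smooth_on S (?T f)" and g: "smooth_on S ?g" and Tg: "smooth_on S (?T ?g)"
    by (intro smooth_intros smooth_on_inverse_block_norm smooth_on_radial_deriv f)+
  \<comment> \<open>Applying \<open>T\<close> to this first-order identity avoids the second derivative of \<open>1/r\<close>.\<close>
  have T: "(block_norm I X)\<^sup>2 *\<^sub>R ?T ?g X = block_norm I X *\<^sub>R ?T f X - ?g X" if "X \<in> S" for X
    using block_norm_nonzero[OF that]
    by (simp add: radial_deriv_inverse_block_norm_scaleR[OF f that] scaleR_diff_right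
        power2_eq_square power3_eq_cube)
  have "?T (\<lambda>X. (block_norm I X)\<^sup>2 *\<^sub>R ?T ?g X) X = ?T (\<lambda>X. block_norm I X *\<^sub>R ?T f X - ?g X) X"
    by (rule radial_deriv_D(2)[OF T X])
  also have "?T (\<lambda>X. (block_norm I X)\<^sup>2 *\<^sub>R ?T ?g X) X = 2 *\<^sub>R ?T ?g X + (block_norm I X)\<^sup>2 *\<^sub>R ?T (?T ?g) X"
    by (simp add: radial_deriv_scaleR[OF smooth_on_block_norm_power2 Tg X] radial_deriv_block_norm_power2[OF X])
  also have "?T (\<lambda>X. block_norm I X *\<^sub>R ?T f X - ?g X) X
      = ?T (\<lambda>X. block_norm I X *\<^sub>R ?T f X) X + ?T (\<lambda>X. (- 1) *\<^sub>R ?g X) X"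
    using radial_deriv_D(3)[OF smooth_on_scaleR[OF smooth_on_block_norm Tf]
        smooth_on_scaleR[OF smooth_on_const[of "- 1"] g] X] by simp
  also have "\<dots> = ?s X *\<^sub>R ?T f X + block_norm I X *\<^sub>R ?T (?T f) X - ?T ?g X"
    unfolding radial_deriv_D(4)[OF g X] radial_deriv_scaleR[OF smooth_on_block_norm Tf X]
    by (simp add: radial_deriv_block_norm[OF X])
  finally have "2 *\<^sub>R ?T ?g X + (block_norm I X)\<^sup>2 *\<^sub>R ?T (?T ?g) X + ?T ?g X
      = ?s X *\<^sub>R ?T f X + block_norm I X *\<^sub>R ?T (?T f) X"
    by simp
  moreover have "3 *\<^sub>R ?T ?g X = 2 *\<^sub>R ?T ?g X + ?T ?g X"
    using scaleR_left_distrib[of 2 1 "?T ?g X"] by simp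
  ultimately show ?thesis
    using block_norm_nonzero[OF X] by (simp add: bessel_def scaleR_add_right power2_eq_square algebra_simps)
qed

end

context block_pair
begin

lemma bessel_pair_inverse_block_norm:
  assumes f: "smooth_on S f" and X: "X \<in> S"
  shows "bessel_pair I J 3 d (\<lambda>X. (1 / block_norm I X) *\<^sub>R f X) X
    = (1 / block_norm I X) *\<^sub>R bessel_pair I J 1 d f X"
proof -
  let ?s = "\<lambda>X. 1 / block_norm I X" and ?U = "radial_deriv J"
  have ps: "partial_deriv j ?s X = 0" if "j \<in> J" "X \<in> S" for j X
    using that disjoint by (auto simp: I.partial_deriv_inverse_block_norm)
  have U: "?U (\<lambda>X. ?s X *\<^sub>R f X) X = ?s X *\<^sub>R ?U f X" if "smooth_on S f" "X \<in> S" for f X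
    by (intro J.radial_deriv_scaleR_const I.smooth_on_inverse_block_norm that ps)
  have "?U (?U (\<lambda>X. ?s X *\<^sub>R f X)) X = ?U (\<lambda>X. ?s X *\<^sub>R ?U f X) X"
    using U[OF f] X by (rule J.radial_deriv_D(2))
  also have "\<dots> = ?s X *\<^sub>R ?U (?U f) X"
    by (rule U[OF J.smooth_on_radial_deriv[OF f] X])
  finally have "bessel J d (\<lambda>X. ?s X *\<^sub>R f X) X = ?s X *\<^sub>R bessel J d f X"
    by (simp add: bessel_def[of J d] U[OF f X] scaleR_add_right mult_ac)
  then show ?thesis
    by (simp add: bessel_pair_def I.bessel_3_inverse_block_norm[OF f X] scaleR_add_right)
qed

lemma biaxial_inverse_block_norm: "biaxial (\<lambda>X. 1 / block_norm I X)"
  unfolding biaxial_def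
  by (intro conjI I.smooth_on_inverse_block_norm I.radialI[of _ "\<lambda>X. - ((1 / block_norm I X) ^ 3)"]
      J.radialI[of _ "\<lambda>X. 0"])
    (use disjoint in \<open>auto simp: I.partial_deriv_inverse_block_norm\<close>)

end

locale holomorphic_biaxial = biaxial_domain S I J
  for S :: "(real ^ 'n::finite) set" and I J +
  fixes \<Xi> :: "complex set"
  assumes open_Xi: "open \<Xi>"
    and radii_in_Xi: "X \<in> S \<Longrightarrow> Complex (block_norm I X) (block_norm J X) \<in> \<Xi>"
begin

text \<open>
  Since \<open>v = Re (\<i> f)\<close> for \<open>f = u - \<i> v\<close>, both \<open>u\<close> and \<open>v\<close> are of this form, and so are, up to
  factors \<open>1/r\<close> and \<open>1/\<rho>\<close>, their radial derivatives.
\<close>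

definition "re_lift f X = Re (f (Complex (block_norm I X) (block_norm J X)))"

lemma re_lift_derivative:
  assumes f: "f holomorphic_on \<Xi>" and X: "X \<in> S"
  shows "re_lift f differentiable (at X)"
    and "partial_deriv j (re_lift f) X = X $ j *\<^sub>R
      (if j \<in> I then (1 / block_norm I X) *\<^sub>R re_lift (deriv f) X
       else (1 / block_norm J X) *\<^sub>R re_lift (\<lambda>z. \<i> * deriv f z) X)"
proof -
  let ?z = "\<lambda>X. Complex (block_norm I X) (block_norm J X)"
  have z: "(?z has_derivative (\<lambda>h. Complex (\<Sum>i\<in>UNIV. h $ i *\<^sub>R partial_deriv i (block_norm I) X)
      (\<Sum>i\<in>UNIV. h $ i *\<^sub>R partial_deriv i (block_norm J) X))) (at X)"
    unfolding Complex_eq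
    by (intro derivative_intros bounded_linear.has_derivative[OF bounded_linear_of_real]
        has_derivative_partial_derivs smooth_on_differentiable[OF I.smooth_on_block_norm X]
        smooth_on_differentiable[OF J.smooth_on_block_norm X])
  have "(f has_field_derivative deriv f (?z X)) (at (?z X))"
    by (rule holomorphic_derivI[OF f open_Xi radii_in_Xi[OF X]])
  then have "(f has_derivative (*) (deriv f (?z X))) (at (?z X))"
    by (simp add: has_field_derivative_def)
  from bounded_linear.has_derivative[OF bounded_linear_Re has_derivative_compose[OF z this]]
  have D: "(re_lift f has_derivative (\<lambda>h. Re (deriv f (?z X) *
      Complex (\<Sum>i\<in>UNIV. h $ i *\<^sub>R partial_deriv i (block_norm I) X)
        (\<Sum>i\<in>UNIV. h $ i *\<^sub>R partial_deriv i (block_norm J) X)))) (at X)"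
    by (simp add: re_lift_def[abs_def])
  then show "re_lift f differentiable (at X)"
    by (auto simp: differentiable_def)
  have sel: "(\<Sum>i\<in>UNIV. (axis j 1 :: real ^ 'n) $ i *\<^sub>R v i) = v j" for v :: "'n \<Rightarrow> real"
    by (simp add: axis_def if_distrib[of "\<lambda>c. c * v _"] cong: if_cong)
  have "j \<in> I \<and> j \<notin> J \<or> j \<notin> I \<and> j \<in> J"
    using cover disjoint by auto
  then show "partial_deriv j (re_lift f) X = X $ j *\<^sub>R
      (if j \<in> I then (1 / block_norm I X) *\<^sub>R re_lift (deriv f) X
       else (1 / block_norm J X) *\<^sub>R re_lift (\<lambda>z. \<i> * deriv f z) X)"
    unfolding partial_deriv_eq_frechet[OF D] sel
    by (auto simp: re_lift_def I.partial_deriv_block_norm[OF X] J.partial_deriv_block_norm[OF X])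
qed

text \<open>The partial derivatives are products of smooth functions with lifts of the holomorphic functions
  \<open>f'\<close> and \<open>\<i> f'\<close>, so the induction runs over all holomorphic functions simultaneously.\<close>

lemma smooth_on_re_lift:
  assumes "f holomorphic_on \<Xi>"
  shows "smooth_on S (re_lift f)"
proof (rule smooth_onI)
  fix n
  from assms show "differentiable_times_on n S (re_lift f)"
  proof (induction n arbitrary: f)
    case (Suc n)
    have f': "deriv f holomorphic_on \<Xi>"
      using Suc.prems open_Xi by (rule holomorphic_deriv)
    have "differentiable_times_on n S (partial_deriv j (re_lift f))" for j
    proof (cases "j \<in> I")
      case True
      have "differentiable_times_on n S (\<lambda>X. X $ j *\<^sub>R (1 / block_norm I X) *\<^sub>R re_lift (deriv f) X)"
        by (intro differentiable_times_on_bilinear[OF bounded_bilinear_scaleR] smooth_on_times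
            smooth_on_coord I.smooth_on_inverse_block_norm Suc.IH f')
      then show ?thesis
        by (rule differentiable_times_on_cong) (simp add: re_lift_derivative(2)[OF Suc.prems] True)
    next
      case False
      have "differentiable_times_on n S
          (\<lambda>X. X $ j *\<^sub>R (1 / block_norm J X) *\<^sub>R re_lift (\<lambda>z. \<i> * deriv f z) X)"
        by (intro differentiable_times_on_bilinear[OF bounded_bilinear_scaleR] smooth_on_times
            smooth_on_coord J.smooth_on_inverse_block_norm Suc.IH f' holomorphic_intros)
      then show ?thesis
        by (rule differentiable_times_on_cong) (simp add: re_lift_derivative(2)[OF Suc.prems] False)
    qed
    then show ?case
      using re_lift_derivative(1)[OF Suc.prems] by simp
  qed simp
qed

lemma radial_deriv_re_lift:
  assumes f: "f holomorphic_on \<Xi>" and X: "X \<in> S"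
  shows "radial_deriv I (re_lift f) X = (1 / block_norm I X) *\<^sub>R re_lift (deriv f) X"
    and "radial_deriv J (re_lift f) X = (1 / block_norm J X) *\<^sub>R re_lift (\<lambda>z. \<i> * deriv f z) X"
proof -
  show "radial_deriv I (re_lift f) X = (1 / block_norm I X) *\<^sub>R re_lift (deriv f) X"
    by (rule I.radial_deriv_eqI[OF _ X]) (simp add: re_lift_derivative(2)[OF f X])
  show "radial_deriv J (re_lift f) X = (1 / block_norm J X) *\<^sub>R re_lift (\<lambda>z. \<i> * deriv f z) X"
    by (rule J.radial_deriv_eqI[OF _ X]) (use disjoint in \<open>auto simp: re_lift_derivative(2)[OF f X]\<close>)
qed

lemma biaxial_re_lift:
  assumes f: "f holomorphic_on \<Xi>"
  shows "biaxial (re_lift f)"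
  unfolding biaxial_def
proof (intro conjI)
  show "smooth_on S (re_lift f)"
    using f by (rule smooth_on_re_lift)
  show "I.radial (re_lift f)"
    by (rule I.radialI[of _ "\<lambda>X. (1 / block_norm I X) *\<^sub>R re_lift (deriv f) X"])
      (simp add: re_lift_derivative(2)[OF f])
  show "J.radial (re_lift f)"
    by (rule J.radialI[of _ "\<lambda>X. (1 / block_norm J X) *\<^sub>R re_lift (\<lambda>z. \<i> * deriv f z) X"])
      (use disjoint in \<open>auto simp: re_lift_derivative(2)[OF f]\<close>)
qed

text \<open>The second derivatives with respect to \<open>r\<close> and \<open>\<rho>\<close> are the real parts of \<open>f''\<close> and \<open>\<i>\<^sup>2 f''\<close>.\<close>

lemma bessel_pair_re_lift:
  assumes f: "f holomorphic_on \<Xi>" and X: "X \<in> S"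
  shows "bessel_pair I J 1 1 (re_lift f) X = 0"
proof -
  have f': "deriv f holomorphic_on \<Xi>" "(\<lambda>z. \<i> * deriv f z) holomorphic_on \<Xi>"
    using f open_Xi by (auto intro!: holomorphic_deriv holomorphic_intros)
  have "bessel I 1 (re_lift f) X = re_lift (deriv (deriv f)) X"
    by (rule I.bessel_1[OF smooth_on_re_lift[OF f'(1)] radial_deriv_re_lift(1)[OF f]
          radial_deriv_re_lift(1)[OF f'(1)] X])
  moreover have "bessel J 1 (re_lift f) X = re_lift (\<lambda>z. \<i> * deriv (\<lambda>z. \<i> * deriv f z) z) X"
    by (rule J.bessel_1[OF smooth_on_re_lift[OF f'(2)] radial_deriv_re_lift(2)[OF f]
          radial_deriv_re_lift(2)[OF f'(2)] X])
  moreover have "deriv (\<lambda>z. \<i> * deriv f z) z = \<i> * deriv (deriv f) z" if "z \<in> \<Xi>" for z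
    using f'(1) open_Xi that by (intro deriv_cmult holomorphic_on_imp_differentiable_at)
  ultimately show ?thesis
    using radii_in_Xi[OF X] by (simp add: bessel_pair_def re_lift_def)
qed

end

section \<open>The two functions without polynomial factors\<close>

definition block_vector ::
    "'n::{finite,linorder} set \<Rightarrow> real ^ 'n::{finite,linorder} \<Rightarrow> 'n clifford" where
  "block_vector I X = (\<Sum>i\<in>I. X $ i *\<^sub>R gen i)"

text \<open>The Euclidean norm on a Clifford algebra is in general not submultiplicative; boundedness of the product
  comes from finite dimension.\<close>

lemma bounded_bilinear_clifford: "bounded_bilinear ((*) :: 'n::{finite,linorder} clifford \<Rightarrow> _)"
  unfolding bilinear_conv_bounded_bilinear[symmetric] bilinear_def
  by (auto intro!: linearI simp: distrib_left distrib_right)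

lemma block_vector_anticommute_gen:
  assumes "j \<notin> I"
  shows "gen j * block_vector I X = - (block_vector I X * gen j)"
proof -
  have "gen j * gen i = - (gen i * gen j)" if "i \<in> I" for i
    using gen_anticommute[of j i] that assms by (auto simp: add_eq_0_iff2)
  then show ?thesis
    by (simp add: block_vector_def sum_distrib_left sum_distrib_right sum_negf[symmetric])
qed

lemma block_vector_anticommute:
  assumes "I \<inter> J = {}"
  shows "block_vector J X * block_vector I X = - (block_vector I X * block_vector J X)"
proof -
  have "gen j * block_vector I X = - (block_vector I X * gen j)" if "j \<in> J" for j
    using assms that by (intro block_vector_anticommute_gen) auto
  then show ?thesis
    by (simp add: block_vector_def[of J] sum_distrib_left sum_distrib_right sum_negf[symmetric])
qed

lemma block_vector_square: "block_vector I X * block_vector I X = - ((block_norm I X)\<^sup>2 *\<^sub>R 1)"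
proof -
  let ?x = "block_vector I X"
  have D: "?x * ?x = (\<Sum>i\<in>I. \<Sum>j\<in>I. (X $ i * X $ j) *\<^sub>R (gen i * gen j))"
    by (simp add: block_vector_def sum_product mult.commute)
  also have "\<dots> = (\<Sum>i\<in>I. \<Sum>j\<in>I. (X $ i * X $ j) *\<^sub>R (gen j * gen i))"
    by (subst sum.swap) (simp add: mult_ac)
  finally have "?x * ?x + ?x * ?x
      = (\<Sum>i\<in>I. \<Sum>j\<in>I. (X $ i * X $ j) *\<^sub>R (gen i * gen j + gen j * gen i))"
    unfolding scaleR_add_right sum.distrib using D by simp
  also have "\<dots> = (\<Sum>i\<in>I. \<Sum>j\<in>I. if i = j then (- 2 * (X $ i)\<^sup>2) *\<^sub>R 1 else 0)"
  proof (intro sum.cong refl)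
    fix i j
    show "(X $ i * X $ j) *\<^sub>R (gen i * gen j + gen j * gen i)
        = (if i = j then (- 2 * (X $ i)\<^sup>2) *\<^sub>R 1 else 0)"
    proof (cases "i = j")
      case True
      have "gen i * gen i + gen i * gen i = (- 2) *\<^sub>R 1"
        using scaleR_left_distrib[of "- 1" "- 1" "1 :: 'a clifford"] by (simp add: gen_square)
      then show ?thesis
        using True by (simp add: power2_eq_square mult_ac)
    qed (simp add: gen_anticommute)
  qed
  also have "\<dots> = 2 *\<^sub>R (- ((block_norm I X)\<^sup>2 *\<^sub>R 1))"
    by (simp add: block_norm_power2 scaleR_sum_left sum_negf scaleR_sum_right)
  finally have "2 *\<^sub>R (?x * ?x) = 2 *\<^sub>R (- ((block_norm I X)\<^sup>2 *\<^sub>R 1))"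
    by (simp only: scaleR_2)
  then show ?thesis
    by (simp del: scaleR_minus_right)
qed

locale biaxial_clifford_domain = biaxial_domain S I J + open_clifford_domain S
  for S :: "(real ^ 'n::{finite,linorder}) set" and I J
begin

lemma smooth_on_block_vector: "smooth_on S (block_vector A)"
  unfolding block_vector_def[abs_def] by (intro smooth_intros)

lemma partial_deriv_block_vector:
  assumes X: "X \<in> S"
  shows "partial_deriv j (block_vector A) X = (if j \<in> A then gen j else 0)"
proof -
  have "partial_deriv j (block_vector A) X = (\<Sum>i\<in>A. partial_deriv j (\<lambda>X. X $ i *\<^sub>R gen i) X)"
    unfolding block_vector_def[abs_def]
    by (intro local_linear_operator_sum[OF local_linear_operator_partial] smooth_intros X)
  also have "\<dots> = (\<Sum>i\<in>A. if i = j then gen i else 0)"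
    by (simp add: partial_deriv_coord_scaleR[OF smooth_on_const X])
  finally show ?thesis
    by simp
qed

lemma sum_split_blocks: "(\<Sum>i\<in>UNIV. g i) = (\<Sum>i\<in>I. g i) + (\<Sum>i\<in>J. g i)" for g :: "'n \<Rightarrow> 'n clifford"
  unfolding cover[symmetric] using disjoint by (intro sum.union_disjoint) auto

text \<open>The gradient of a biaxial function, read as a Clifford vector, is \<open>T h x + S h y\<close> with the two radial
  derivatives \<open>T\<close> and \<open>S\<close>.\<close>

lemma dirac_scaleR_biaxial:
  assumes h: "biaxial h" and G: "smooth_on S G" and X: "X \<in> S"
  shows "dirac (\<lambda>X. h X *\<^sub>R G X) X
    = (radial_deriv I h X *\<^sub>R block_vector I X + radial_deriv J h X *\<^sub>R block_vector J X) * G X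
      + h X *\<^sub>R dirac G X"
proof -
  have sm: "smooth_on S h" and rad: "I.radial h" "J.radial h"
    using h by (simp_all add: biaxial_def)
  have "dirac (\<lambda>X. h X *\<^sub>R G X) X = (\<Sum>j\<in>UNIV. partial_deriv j h X *\<^sub>R gen j) * G X + h X *\<^sub>R dirac G X"
    by (simp add: dirac_def partial_deriv_scaleR_smooth[OF sm G X] distrib_left sum.distrib
        sum_distrib_right scaleR_sum_right)
  also have "(\<Sum>j\<in>UNIV. partial_deriv j h X *\<^sub>R gen j)
      = radial_deriv I h X *\<^sub>R block_vector I X + radial_deriv J h X *\<^sub>R block_vector J X"
    unfolding sum_split_blocks
    by (simp add: block_vector_def I.radialD[OF rad(1) X] J.radialD[OF rad(2) X] scaleR_sum_right mult_ac)
  finally show ?thesis .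
qed

lemma dirac_block_vector:
  assumes X: "X \<in> S"
  shows "dirac (block_vector A) X = - real (card A) *\<^sub>R 1"
proof -
  have "dirac (block_vector A) X = (\<Sum>j\<in>UNIV. if j \<in> A then - 1 else 0)"
    unfolding dirac_def
    by (intro sum.cong) (auto simp: partial_deriv_block_vector[OF X] gen_square)
  also have "\<dots> = (\<Sum>j\<in>A. - 1)"
    by (simp add: sum.If_cases)
  also have "\<dots> = - real (card A) *\<^sub>R 1"
    by (simp add: sum_constant_scaleR scaleR_conv_of_real)
  finally show ?thesis .
qed

lemma dirac_block_vector_product:
  assumes X: "X \<in> S"
  shows "dirac (\<lambda>X. block_vector I X * block_vector J X) X
    = real (card J) *\<^sub>R block_vector I X - real (card I) *\<^sub>R block_vector J X"
proof -
  let ?x = "block_vector I X" and ?y = "block_vector J X"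
  note d = smooth_on_differentiable[OF smooth_on_block_vector X]
  have p: "gen j * partial_deriv j (\<lambda>X. block_vector I X * block_vector J X) X
      = gen j * ((if j \<in> I then gen j else 0) * ?y + ?x * (if j \<in> J then gen j else 0))" for j
    by (simp add: partial_deriv_bilinear[OF bounded_bilinear_clifford d d] partial_deriv_block_vector[OF X])
  have pI: "gen j * partial_deriv j (\<lambda>X. block_vector I X * block_vector J X) X = - ?y" if "j \<in> I" for j
    using that disjoint unfolding p by (auto simp: gen_square simp flip: mult.assoc)
  have pJ: "gen j * partial_deriv j (\<lambda>X. block_vector I X * block_vector J X) X = ?x" if "j \<in> J" for j
  proof -
    have "j \<notin> I"
      using that disjoint by auto
    then have "gen j * (?x * gen j) = ?x"
      by (simp add: block_vector_anticommute_gen mult.assoc gen_square flip: mult.assoc[of "gen j"])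
    then show ?thesis
      using that \<open>j \<notin> I\<close> unfolding p by simp
  qed
  show ?thesis
    unfolding dirac_def sum_split_blocks by (simp add: pI pJ sum_constant_scaleR del: sum_constant)
qed

lemma laplacian_funpow_scaleR_const:
  assumes "smooth_on S h" "X \<in> S"
  shows "(laplacian ^^ n) (\<lambda>X. h X *\<^sub>R a) X = (laplacian ^^ n) h X *\<^sub>R a"
  by (rule laplacian_funpow_linear[OF bounded_linear_scaleR_left assms])

text \<open>Componentwise, the factor \<open>x\<close> replaces dimension \<open>p\<close> by \<open>p + 2\<close>.\<close>

lemma laplacian_funpow_scaleR_block_vector:
  assumes h: "biaxial h" and X: "X \<in> S"
    and zero: "(bessel_pair I J (real (card I) + 2) (real (card J)) ^^ n) h X = 0"
  shows "(laplacian ^^ n) (\<lambda>X. h X *\<^sub>R block_vector I X) X = 0"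
proof -
  have sm: "smooth_on S h"
    using h by (simp add: biaxial_def)
  have "(laplacian ^^ n) (\<lambda>X. h X *\<^sub>R block_vector I X) X
      = (laplacian ^^ n) (\<lambda>X. \<Sum>i\<in>I. (X $ i *\<^sub>R h X) *\<^sub>R gen i) X"
    by (simp add: block_vector_def scaleR_sum_right mult_ac)
  also have "\<dots> = (\<Sum>i\<in>I. (laplacian ^^ n) (\<lambda>X. (X $ i *\<^sub>R h X) *\<^sub>R gen i) X)"
    by (intro local_linear_operator_sum[OF local_linear_operator_funpow[OF local_linear_operator_laplacian]]
        smooth_intros sm X)
  also have "\<dots> = (\<Sum>i\<in>I. (laplacian ^^ n) (\<lambda>X. X $ i *\<^sub>R h X) X *\<^sub>R gen i)"
    by (intro sum.cong refl laplacian_funpow_scaleR_const smooth_intros sm X)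
  also have "\<dots> = 0"
    by (intro sum.neutral) (simp add: laplacian_funpow_coord_biaxial[OF h _ X] zero del: real_scaleR_def)
  finally show ?thesis .
qed

lemma premonogenicI:
  assumes F: "smooth_on S F" and D: "\<And>X. X \<in> S \<Longrightarrow> dirac F X = D X"
    and "\<And>X. X \<in> S \<Longrightarrow> (laplacian ^^ n) D X = 0"
  shows "premonogenic n F"
  unfolding premonogenic_def
proof (intro conjI ballI)
  fix X assume X: "X \<in> S"
  have "(laplacian ^^ n) (dirac F) X = (laplacian ^^ n) D X"
    by (rule laplacian_funpow_D(2)[OF D X])
  with X assms(3) show "dirac ((laplacian ^^ n) F) X = 0"
    by (simp add: dirac_laplacian_funpow[OF F X])
qed (rule F)

end

locale holomorphic_clifford_domain =
  biaxial_clifford_domain S I J + holomorphic_biaxial S I J \<Xi>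
  for S :: "(real ^ 'n::{finite,linorder}) set" and I J \<Xi>
begin

context
  fixes f :: "complex \<Rightarrow> complex" and a b :: nat
  assumes f: "f holomorphic_on \<Xi>"
    and card_I: "card I = 2 * a + 1" and card_J: "card J = 2 * b + 1"
begin

interpretation sw: biaxial_clifford_domain S J I
  by (intro biaxial_clifford_domain.intro swap_biaxial open_clifford_domain_axioms)

text \<open>
  The two functions to be studied are \<open>U + W x y\<close> and \<open>A x + B y\<close>, where \<open>U\<close> and \<open>V\<close> stand for \<open>u\<close> and \<open>v\<close>
  at the two radii.
\<close>

private abbreviation (input) "r \<equiv> block_norm I"
private abbreviation (input) "\<rho> \<equiv> block_norm J"
private abbreviation (input) "x \<equiv> block_vector I"
private abbreviation (input) "y \<equiv> block_vector J"
private abbreviation (input) "U \<equiv> re_lift f"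
private abbreviation (input) "V \<equiv> re_lift (\<lambda>z. \<i> * f z)"
private abbreviation (input) "A \<equiv> \<lambda>X. (1 / r X) *\<^sub>R U X"
private abbreviation (input) "B \<equiv> \<lambda>X. (1 / \<rho> X) *\<^sub>R V X"
private abbreviation (input) "W \<equiv> \<lambda>X. (1 / r X) *\<^sub>R ((1 / \<rho> X) *\<^sub>R V X)"

lemma times_i_holomorphic: "(\<lambda>z. \<i> * f z) holomorphic_on \<Xi>"
  using f by (intro holomorphic_intros)

lemma biaxial_components: "biaxial U" "biaxial V" "biaxial A" "biaxial B" "biaxial W"
proof -
  show *: "biaxial U" "biaxial V"
    by (intro biaxial_re_lift f times_i_holomorphic)+
  show "biaxial A" "biaxial B" "biaxial W"
    by (intro biaxial_scaleR biaxial_inverse_block_norm *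
        sw.biaxial_inverse_block_norm[unfolded biaxial_swap])+
qed

lemma smooth_components: "smooth_on S U" "smooth_on S V" "smooth_on S A" "smooth_on S B" "smooth_on S W"
  using biaxial_components unfolding biaxial_def by blast+

text \<open>These are the Cauchy-Riemann equations: \<open>U\<^sub>r = - V\<^sub>\<rho>\<close> and \<open>U\<^sub>\<rho> = V\<^sub>r\<close>.\<close>

lemma radial_derivs_UV:
  assumes X: "X \<in> S"
  shows "radial_deriv I U X = (1 / r X) * re_lift (deriv f) X"
    and "radial_deriv J U X = (1 / \<rho> X) * re_lift (\<lambda>z. \<i> * deriv f z) X"
    and "radial_deriv I V X = (1 / r X) * re_lift (\<lambda>z. \<i> * deriv f z) X"
    and "radial_deriv J V X = - (1 / \<rho> X) * re_lift (deriv f) X"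
proof -
  have d: "deriv (\<lambda>z. \<i> * f z) z = \<i> * deriv f z" if "z \<in> \<Xi>" for z
    using f open_Xi that by (intro deriv_cmult holomorphic_on_imp_differentiable_at)
  show "radial_deriv I U X = (1 / r X) * re_lift (deriv f) X"
    "radial_deriv J U X = (1 / \<rho> X) * re_lift (\<lambda>z. \<i> * deriv f z) X"
    using radial_deriv_re_lift[OF f X] by simp_all
  show "radial_deriv I V X = (1 / r X) * re_lift (\<lambda>z. \<i> * deriv f z) X"
    "radial_deriv J V X = - (1 / \<rho> X) * re_lift (deriv f) X"
    using radial_deriv_re_lift[OF times_i_holomorphic X] d[OF radii_in_Xi[OF X]]
    by (simp_all add: re_lift_def)
qed

lemma bessel_pair_A:
  assumes "X \<in> S" shows "bessel_pair I J 3 1 A X = 0"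
  using bessel_pair_inverse_block_norm[OF smooth_components(1) assms] bessel_pair_re_lift[OF f assms] by simp

lemma bessel_pair_B:
  assumes "X \<in> S" shows "bessel_pair I J 1 3 B X = 0"
  using sw.bessel_pair_inverse_block_norm[OF smooth_components(2) assms]
    bessel_pair_re_lift[OF times_i_holomorphic assms] by (simp add: bessel_pair_swap[of J I])

lemma bessel_pair_W:
  assumes "X \<in> S" shows "bessel_pair I J 3 3 W X = 0"
  using bessel_pair_inverse_block_norm[OF smooth_components(4) assms] bessel_pair_B[OF assms] by simp

text \<open>
  The function \<open>A\<close> is annihilated in dimensions \<open>(3, 1)\<close>, from which \<open>(p, q)\<close> differs by
  \<open>(2 (a - 1), 2 b)\<close>. This presupposes \<open>p \<ge> 3\<close>; for \<open>p = 1\<close> the factor \<open>2 a\<close> in front of \<open>A\<close> vanishes. The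
  count is the same for \<open>B\<close> and \<open>W x\<close>, where it presupposes \<open>q \<ge> 3\<close>, and for \<open>W y\<close>, where it presupposes
  \<open>p \<ge> 3\<close>.
\<close>

lemma laplacian_A:
  assumes X: "X \<in> S" and a: "a > 0"
  shows "(laplacian ^^ (a + b)) A X = 0"
proof -
  have e: "3 + 2 * real (a - 1) = real (card I)" "1 + 2 * real b = real (card J)" "Suc (a - 1 + b) = a + b"
    using a by (simp_all add: card_I card_J of_nat_diff)
  have "(bessel_pair I J (3 + 2 * real (a - 1)) (1 + 2 * real b) ^^ Suc (a - 1 + b)) A X = 0"
    by (rule bessel_pair_funpow_eq_0[OF smooth_components(3) bessel_pair_A X])
  then show ?thesis
    unfolding laplacian_funpow_biaxial[OF biaxial_components(3) X] by (simp only: e)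
qed

lemma laplacian_B:
  assumes X: "X \<in> S" and b: "b > 0"
  shows "(laplacian ^^ (a + b)) B X = 0"
proof -
  have e: "1 + 2 * real a = real (card I)" "3 + 2 * real (b - 1) = real (card J)" "Suc (a + (b - 1)) = a + b"
    using b by (simp_all add: card_I card_J of_nat_diff)
  have "(bessel_pair I J (1 + 2 * real a) (3 + 2 * real (b - 1)) ^^ Suc (a + (b - 1))) B X = 0"
    by (rule bessel_pair_funpow_eq_0[OF smooth_components(4) bessel_pair_B X])
  then show ?thesis
    unfolding laplacian_funpow_biaxial[OF biaxial_components(4) X] by (simp only: e)
qed

lemma laplacian_Wx:
  assumes X: "X \<in> S" and b: "b > 0"
  shows "(laplacian ^^ (a + b)) (\<lambda>X. W X *\<^sub>R x X) X = 0"
proof (rule laplacian_funpow_scaleR_block_vector[OF biaxial_components(5) X])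
  have e: "3 + 2 * real a = real (card I) + 2" "3 + 2 * real (b - 1) = real (card J)" "Suc (a + (b - 1)) = a + b"
    using b by (simp_all add: card_I card_J of_nat_diff)
  have "(bessel_pair I J (3 + 2 * real a) (3 + 2 * real (b - 1)) ^^ Suc (a + (b - 1))) W X = 0"
    by (rule bessel_pair_funpow_eq_0[OF smooth_components(5) bessel_pair_W X])
  then show "(bessel_pair I J (real (card I) + 2) (real (card J)) ^^ (a + b)) W X = 0"
    by (simp only: e)
qed

lemma laplacian_Wy:
  assumes X: "X \<in> S" and a: "a > 0"
  shows "(laplacian ^^ (a + b)) (\<lambda>X. W X *\<^sub>R y X) X = 0"
proof (rule sw.laplacian_funpow_scaleR_block_vector[unfolded biaxial_swap, OF biaxial_components(5) X])
  have e: "3 + 2 * real (a - 1) = real (card I)" "3 + 2 * real b = real (card J) + 2" "Suc (a - 1 + b) = a + b"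
    using a by (simp_all add: card_I card_J of_nat_diff)
  have "(bessel_pair I J (3 + 2 * real (a - 1)) (3 + 2 * real b) ^^ Suc (a - 1 + b)) W X = 0"
    by (rule bessel_pair_funpow_eq_0[OF smooth_components(5) bessel_pair_W X])
  then show "(bessel_pair J I (real (card J) + 2) (real (card I)) ^^ (a + b)) W X = 0"
    unfolding bessel_pair_swap[of J I] by (simp only: e)
qed

lemma radial_derivs_A:
  assumes X: "X \<in> S"
  shows "(r X)\<^sup>2 * radial_deriv I A X = re_lift (deriv f) X - A X"
    and "radial_deriv J A X = (1 / r X) * (1 / \<rho> X) * re_lift (\<lambda>z. \<i> * deriv f z) X"
proof -
  show "(r X)\<^sup>2 * radial_deriv I A X = re_lift (deriv f) X - A X"
    using I.block_norm_nonzero[OF X]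
    unfolding I.radial_deriv_inverse_block_norm_scaleR[OF smooth_components(1) X] radial_derivs_UV[OF X]
    by (simp add: power2_eq_square power3_eq_cube field_simps)
  have "radial_deriv J A X = (1 / r X) *\<^sub>R radial_deriv J U X"
    using disjoint by (intro J.radial_deriv_scaleR_const I.smooth_on_inverse_block_norm smooth_components X)
      (auto simp: I.partial_deriv_inverse_block_norm[OF X])
  then show "radial_deriv J A X = (1 / r X) * (1 / \<rho> X) * re_lift (\<lambda>z. \<i> * deriv f z) X"
    by (simp add: radial_derivs_UV[OF X])
qed

lemma radial_derivs_B:
  assumes X: "X \<in> S"
  shows "(\<rho> X)\<^sup>2 * radial_deriv J B X = - re_lift (deriv f) X - B X"
    and "radial_deriv I B X = (1 / r X) * (1 / \<rho> X) * re_lift (\<lambda>z. \<i> * deriv f z) X"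
proof -
  show "(\<rho> X)\<^sup>2 * radial_deriv J B X = - re_lift (deriv f) X - B X"
    using J.block_norm_nonzero[OF X]
    unfolding J.radial_deriv_inverse_block_norm_scaleR[OF smooth_components(2) X] radial_derivs_UV[OF X]
    by (simp add: power2_eq_square power3_eq_cube field_simps)
  have "radial_deriv I B X = (1 / \<rho> X) *\<^sub>R radial_deriv I V X"
    using disjoint by (intro I.radial_deriv_scaleR_const J.smooth_on_inverse_block_norm smooth_components X)
      (auto simp: J.partial_deriv_inverse_block_norm[OF X])
  then show "radial_deriv I B X = (1 / r X) * (1 / \<rho> X) * re_lift (\<lambda>z. \<i> * deriv f z) X"
    by (simp add: radial_derivs_UV[OF X])
qed

lemma radial_derivs_W:
  assumes X: "X \<in> S"
  shows "(r X)\<^sup>2 * radial_deriv I W X = radial_deriv J U X - W X"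
    and "(\<rho> X)\<^sup>2 * radial_deriv J W X = - radial_deriv I U X - W X"
proof -
  show "(r X)\<^sup>2 * radial_deriv I W X = radial_deriv J U X - W X"
    using I.block_norm_nonzero[OF X]
    unfolding I.radial_deriv_inverse_block_norm_scaleR[OF smooth_components(4) X]
      radial_derivs_UV[OF X] radial_derivs_B(2)[OF X]
    by (simp add: power2_eq_square power3_eq_cube field_simps)
  have "radial_deriv J W X = (1 / r X) *\<^sub>R radial_deriv J B X"
    using disjoint by (intro J.radial_deriv_scaleR_const I.smooth_on_inverse_block_norm smooth_components X)
      (auto simp: I.partial_deriv_inverse_block_norm[OF X])
  then have "(\<rho> X)\<^sup>2 * radial_deriv J W X = (1 / r X) * ((\<rho> X)\<^sup>2 * radial_deriv J B X)"
    by simp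
  also have "\<dots> = - radial_deriv I U X - W X"
    unfolding radial_derivs_B(1)[OF X] radial_derivs_UV[OF X] by (simp add: algebra_simps)
  finally show "(\<rho> X)\<^sup>2 * radial_deriv J W X = - radial_deriv I U X - W X" .
qed

text \<open>
  The product rule gives \<open>x (T U + \<rho>\<^sup>2 S W + q W) + y (S U - r\<^sup>2 T W - p W)\<close>, where \<open>T\<close> and \<open>S\<close> are the radial
  derivatives. As \<open>W = V/(r \<rho>)\<close>, the Cauchy-Riemann equations turn \<open>\<rho>\<^sup>2 S W\<close> into \<open>- T U - W\<close> and \<open>r\<^sup>2 T W\<close>
  into \<open>S U - W\<close>.
\<close>

lemma dirac_bivector_form:
  assumes X: "X \<in> S"
  shows "dirac (\<lambda>X. U X *\<^sub>R 1 + W X *\<^sub>R (x X * y X)) X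
    = (2 * real b) *\<^sub>R (W X *\<^sub>R x X) + (- 2 * real a) *\<^sub>R (W X *\<^sub>R y X)"
proof -
  let ?TU = "radial_deriv I U X" and ?SU = "radial_deriv J U X"
  let ?TW = "radial_deriv I W X" and ?SW = "radial_deriv J W X"
  have xy: "smooth_on S (\<lambda>X. x X * y X)"
    by (intro smooth_on_bilinear[OF bounded_bilinear_clifford] smooth_on_block_vector)
  have d1: "dirac (\<lambda>X. 1) X = (0 :: 'n clifford)"
    by (simp add: dirac_def)
  have xxy: "x X * (x X * y X) = - ((r X)\<^sup>2 *\<^sub>R y X)"
    by (simp add: block_vector_square flip: mult.assoc)
  have "y X * (x X * y X) = - (x X * (y X * y X))"
    using block_vector_anticommute[OF disjoint, of X] by (simp flip: mult.assoc)
  then have yxy: "y X * (x X * y X) = (\<rho> X)\<^sup>2 *\<^sub>R x X"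
    by (simp add: block_vector_square)
  have "dirac (\<lambda>X. U X *\<^sub>R 1 + W X *\<^sub>R (x X * y X)) X
      = dirac (\<lambda>X. U X *\<^sub>R 1) X + dirac (\<lambda>X. W X *\<^sub>R (x X * y X)) X"
    by (intro dirac_D smooth_intros smooth_components xy X)
  also have "dirac (\<lambda>X. U X *\<^sub>R 1) X = ?TU *\<^sub>R x X + ?SU *\<^sub>R y X"
    by (simp add: dirac_scaleR_biaxial[OF biaxial_components(1) smooth_on_const X] d1)
  also have "dirac (\<lambda>X. W X *\<^sub>R (x X * y X)) X
      = ((\<rho> X)\<^sup>2 * ?SW) *\<^sub>R x X - ((r X)\<^sup>2 * ?TW) *\<^sub>R y X
        + W X *\<^sub>R (real (card J) *\<^sub>R x X - real (card I) *\<^sub>R y X)"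
    unfolding dirac_scaleR_biaxial[OF biaxial_components(5) xy X] dirac_block_vector_product[OF X]
    by (simp add: distrib_right xxy yxy mult_ac)
  finally show ?thesis
    unfolding radial_derivs_W[OF X] card_I card_J by (simp add: algebra_simps)
qed

text \<open>
  The bivector part is \<open>(T B - S A) x y\<close>, and \<open>T B = S A\<close> by the second Cauchy-Riemann equation. In the
  scalar part the first one cancels \<open>U\<^sub>r\<close> against \<open>V\<^sub>\<rho>\<close>.
\<close>

lemma dirac_vector_form:
  assumes X: "X \<in> S"
  shows "dirac (\<lambda>X. A X *\<^sub>R x X + B X *\<^sub>R y X) X
    = (- 2 * real a) *\<^sub>R (A X *\<^sub>R 1) + (- 2 * real b) *\<^sub>R (B X *\<^sub>R 1)"
proof -
  let ?TA = "radial_deriv I A X" and ?SA = "radial_deriv J A X"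
  let ?TB = "radial_deriv I B X" and ?SB = "radial_deriv J B X"
  define P where "P = (r X)\<^sup>2 * ?TA + real (card I) * A X"
  define Q where "Q = (\<rho> X)\<^sup>2 * ?SB + real (card J) * B X"
  have yx: "y X * x X = - (x X * y X)"
    by (rule block_vector_anticommute[OF disjoint])
  have "dirac (\<lambda>X. A X *\<^sub>R x X + B X *\<^sub>R y X) X
      = dirac (\<lambda>X. A X *\<^sub>R x X) X + dirac (\<lambda>X. B X *\<^sub>R y X) X"
    by (intro dirac_D smooth_intros smooth_components smooth_on_block_vector X)
  also have "dirac (\<lambda>X. A X *\<^sub>R x X) X
      = - P *\<^sub>R 1 - ?SA *\<^sub>R (x X * y X)"
    unfolding P_def dirac_scaleR_biaxial[OF biaxial_components(3) smooth_on_block_vector X] dirac_block_vector[OF X]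
    by (simp add: distrib_right block_vector_square yx scaleR_add_left scaleR_diff_left mult_ac)
  also have "dirac (\<lambda>X. B X *\<^sub>R y X) X
      = - Q *\<^sub>R 1 + ?TB *\<^sub>R (x X * y X)"
    unfolding Q_def dirac_scaleR_biaxial[OF biaxial_components(4) smooth_on_block_vector X] dirac_block_vector[OF X]
    by (simp add: distrib_right block_vector_square scaleR_add_left scaleR_diff_left mult_ac)
  finally have "dirac (\<lambda>X. A X *\<^sub>R x X + B X *\<^sub>R y X) X = (- P - Q) *\<^sub>R 1"
    unfolding radial_derivs_A(2)[OF X] radial_derivs_B(2)[OF X] scaleR_diff_left by simp
  also have "- P - Q = - 2 * real a * A X + - 2 * real b * B X"
    unfolding P_def Q_def radial_derivs_A(1)[OF X] radial_derivs_B(1)[OF X] card_I card_J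
    by (simp add: algebra_simps add_divide_distrib)
  finally show ?thesis
    by (simp only: scaleR_add_left scaleR_scaleR)
qed

lemma premonogenic_bivector_form: "premonogenic (a + b) (\<lambda>X. U X *\<^sub>R 1 + W X *\<^sub>R (x X * y X))"
proof (rule premonogenicI[OF _ dirac_bivector_form])
  show "smooth_on S (\<lambda>X. U X *\<^sub>R 1 + W X *\<^sub>R (x X * y X))"
    by (intro smooth_intros smooth_on_bilinear[OF bounded_bilinear_clifford] smooth_components
        smooth_on_block_vector)
  show "(laplacian ^^ (a + b))
      (\<lambda>X. (2 * real b) *\<^sub>R (W X *\<^sub>R x X) + (- 2 * real a) *\<^sub>R (W X *\<^sub>R y X)) X = 0" if "X \<in> S" for X
    by (rule laplacian_funpow_combination[OF _ _ that laplacian_Wx[OF that] laplacian_Wy[OF that]])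
      (intro smooth_intros smooth_components smooth_on_block_vector | simp)+
qed

lemma premonogenic_vector_form: "premonogenic (a + b) (\<lambda>X. A X *\<^sub>R x X + B X *\<^sub>R y X)"
proof (rule premonogenicI[OF _ dirac_vector_form])
  show "smooth_on S (\<lambda>X. A X *\<^sub>R x X + B X *\<^sub>R y X)"
    by (intro smooth_intros smooth_components smooth_on_block_vector)
  have A1: "(laplacian ^^ (a + b)) (\<lambda>X. A X *\<^sub>R (1 :: 'n clifford)) X = 0" if "X \<in> S" "a > 0" for X
    unfolding laplacian_funpow_scaleR_const[OF smooth_components(3) that(1)] laplacian_A[OF that] by simp
  have B1: "(laplacian ^^ (a + b)) (\<lambda>X. B X *\<^sub>R (1 :: 'n clifford)) X = 0" if "X \<in> S" "b > 0" for X
    unfolding laplacian_funpow_scaleR_const[OF smooth_components(4) that(1)] laplacian_B[OF that] by simp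
  show "(laplacian ^^ (a + b))
      (\<lambda>X. (- 2 * real a) *\<^sub>R (A X *\<^sub>R 1) + (- 2 * real b) *\<^sub>R (B X *\<^sub>R (1 :: 'n clifford))) X = 0"
    if "X \<in> S" for X
    by (rule laplacian_funpow_combination[OF _ _ that A1[OF that] B1[OF that]])
      (intro smooth_intros smooth_components | simp)+
qed

end

end

section \<open>Antiholomorphic functions and the splitting of the coordinates\<close>

text \<open>The vanishing Wirtinger derivative makes the real derivative of \<open>w\<close> antilinear over the complex
  numbers, so that its conjugate is complex linear.\<close>

lemma antiholomorphic_on_imp_cnj_holomorphic_on:
  assumes "antiholomorphic_on w S" "open S"
  shows "(\<lambda>z. cnj (w z)) holomorphic_on S"
  unfolding holomorphic_on_open[OF assms(2)]
proof
  fix z assume z: "z \<in> S"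
  obtain D where D: "(w has_derivative D) (at z)"
    using assms(1) z by (auto simp: antiholomorphic_on_def differentiable_def)
  interpret D: bounded_linear D
    using D by (rule has_derivative_bounded_linear)
  have dir: "vector_derivative (\<lambda>t. w (z + c * of_real t)) (at 0) = D c" for c
  proof -
    have "((\<lambda>t. z + c * of_real t) has_derivative (\<lambda>t. c * of_real t)) (at 0)"
      by (auto intro!: derivative_eq_intros)
    from has_derivative_compose[OF this, of w D] D
    have "((\<lambda>t. w (z + c * of_real t)) has_derivative (\<lambda>t. D (c * of_real t))) (at 0)"
      by simp
    moreover have "D (c * of_real t) = t *\<^sub>R D c" for t
    proof -
      have "c * of_real t = t *\<^sub>R c"
        by (simp add: scaleR_conv_of_real mult.commute)
      then show ?thesis
        by (simp only: D.scaleR)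
    qed
    ultimately show ?thesis
      by (intro vector_derivative_at) (simp add: has_vector_derivative_def)
  qed
  have "D 1 - \<i> * D \<i> = 0"
    using assms(1) z dir[of 1] dir[of \<i>] by (auto simp: antiholomorphic_on_def wirtinger_deriv_def)
  then have Di: "D \<i> = - \<i> * D 1"
    by (simp add: algebra_simps complex_eq_iff)
  have "cnj (D h) = cnj (D 1) * h" for h
  proof -
    have "D h = Re h *\<^sub>R D 1 + Im h *\<^sub>R D \<i>"
      unfolding D.scaleR[symmetric] D.add[symmetric]
      by (intro arg_cong[where f = D]) (simp add: complex_eq_iff)
    then show ?thesis
      by (simp add: Di complex_eq_iff algebra_simps)
  qed
  then have "(\<lambda>h. cnj (D h)) = (*) (cnj (D 1))"
    by (rule ext)
  with bounded_linear.has_derivative[OF bounded_linear_cnj D]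
  have "((\<lambda>z. cnj (w z)) has_derivative (*) (cnj (D 1))) (at z)"
    by (simp only:)
  then show "\<exists>f'. ((\<lambda>z. cnj (w z)) has_field_derivative f') (at z)"
    by (auto simp: has_field_derivative_def)
qed

lemma block_norm_left: "block_norm (range Inl) X = norm (left_part X)"
  by (simp add: block_norm_def norm_vec_def L2_set_def left_part_def sum.reindex)

lemma block_norm_right: "block_norm (range Inr) X = norm (right_part X)"
  by (simp add: block_norm_def norm_vec_def L2_set_def right_part_def sum.reindex)

lemma block_vector_left: "block_vector (range Inl) X = left_vector (left_part X)"
  by (simp add: block_vector_def left_vector_def left_part_def sum.reindex)

lemma block_vector_right: "block_vector (range Inr) X = right_vector (right_part X)"
  by (simp add: block_vector_def right_vector_def right_part_def sum.reindex)

theorem theorem5: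
  fixes k l :: nat
    and \<Xi> :: "complex set"
    and w :: "complex \<Rightarrow> complex"
    and u v :: "real \<Rightarrow> real \<Rightarrow> real"
    and H\<^sub>k :: "real ^ 'p::{finite,linorder} \<Rightarrow> ('p + 'q::{finite,linorder}) clifford"
    and H\<^sub>l :: "real ^ 'q::{finite,linorder} \<Rightarrow> ('p + 'q) clifford"
    and \<Omega> :: "(real ^ ('p + 'q)) set"
  assumes "odd CARD('p)" and "odd CARD('q)"
    and "open \<Xi>" and "\<Xi> \<subseteq> {z. 0 < Re z \<and> 0 < Im z}"
    and "antiholomorphic_on w \<Xi>"
    and "\<And>x y. Complex x y \<in> \<Xi> \<Longrightarrow> w (Complex x y) = of_real (u x y) + \<i> * of_real (v x y)"
    and "homogeneous_polynomial left_subalgebra k H\<^sub>k"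
    and "homogeneous_polynomial right_subalgebra l H\<^sub>l"
    and "\<Omega> = {X. Complex (norm (left_part X)) (norm (right_part X)) \<in> \<Xi>}"
  shows "
    monogenic_on
      ((laplacian ^^ (k + l + (CARD('p + 'q) - 2) div 2))
        (\<lambda>X. let x = left_part X; y = right_part X in
          (of_real (u (norm x) (norm y))
            + (v (norm x) (norm y) / (norm x * norm y)) *\<^sub>R (left_vector x * right_vector y))
          * H\<^sub>k x * H\<^sub>l y)) \<Omega> \<and>
    monogenic_on
      ((laplacian ^^ (k + l + (CARD('p + 'q) - 2) div 2))
        (\<lambda>X. let x = left_part X; y = right_part X in
          ((u (norm x) (norm y) / norm x) *\<^sub>R left_vector x
            + (v (norm x) (norm y) / norm y) *\<^sub>R right_vector y)
          * H\<^sub>k x * H\<^sub>l y)) \<Omega>"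
proof -
  let ?I = "range Inl :: ('p + 'q) set" and ?J = "range Inr :: ('p + 'q) set"
  obtain a b where ab: "CARD('p) = 2 * a + 1" "CARD('q) = 2 * b + 1"
    using assms(1,2) by (auto elim!: oddE)
  have N: "a + b + k + l = k + l + (CARD('p + 'q) - 2) div 2"
    by (simp add: ab card_UNIV_sum)
  have card: "card ?I = 2 * a + 1" "card ?J = 2 * b + 1"
    by (simp_all add: card_image ab)
  have \<Omega>: "Complex (block_norm ?I X) (block_norm ?J X) \<in> \<Xi> \<longleftrightarrow> X \<in> \<Omega>" for X
    by (simp add: assms(9) block_norm_left block_norm_right)
  have "open \<Omega>"
  proof -
    have "continuous_on UNIV (\<lambda>X :: real ^ ('p + 'q). Complex (norm (left_part X)) (norm (right_part X)))"
      unfolding left_part_def right_part_def Complex_eq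
      by (intro continuous_intros continuous_on_of_real continuous_on_vec_lambda)
    from continuous_open_preimage[OF this open_UNIV assms(3)] show ?thesis
      by (simp add: assms(9) vimage_def)
  qed
  interpret holomorphic_clifford_domain \<Omega> ?I ?J \<Xi>
  proof unfold_locales
    show "block_norm ?I X \<noteq> 0" "block_norm ?J X \<noteq> 0" if "X \<in> \<Omega>" for X
      using that assms(4) \<Omega>[of X] by auto
    show "?I \<union> ?J = UNIV"
      by (auto simp: UNIV_sum)
  qed (use \<open>open \<Omega>\<close> assms(3) \<Omega> in auto)
  let ?f = "\<lambda>z. cnj (w z)"
  have f: "?f holomorphic_on \<Xi>"
    using assms(5,3) by (rule antiholomorphic_on_imp_cnj_holomorphic_on)
  have uv: "re_lift ?f X = u (norm (left_part X)) (norm (right_part X))"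
    "re_lift (\<lambda>z. \<i> * ?f z) X = v (norm (left_part X)) (norm (right_part X))" if "X \<in> \<Omega>" for X
    using assms(6)[of "norm (left_part X)" "norm (right_part X)"] that
    by (simp_all add: re_lift_def block_norm_left block_norm_right assms(9))
  have mono: "monogenic_on
      ((laplacian ^^ (k + l + (CARD('p + 'q) - 2) div 2)) (\<lambda>X. F X * H\<^sub>k (left_part X) * H\<^sub>l (right_part X))) \<Omega>"
    if "premonogenic (a + b) F" for F
    using premonogenic_monogenic[OF premonogenic_mult_homogeneous[OF
          premonogenic_mult_homogeneous[OF that assms(7), of Inl] assms(8), of Inr]]
    by (simp add: N left_part_def right_part_def)
  show ?thesis
    unfolding Let_def
  proof (intro conjI mono)
    show "premonogenic (a + b) (\<lambda>X. of_real (u (norm (left_part X)) (norm (right_part X)))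
        + (v (norm (left_part X)) (norm (right_part X)) / (norm (left_part X) * norm (right_part X)))
          *\<^sub>R (left_vector (left_part X) * right_vector (right_part X)))"
      by (rule premonogenic_cong[OF premonogenic_bivector_form[OF f card]])
        (simp add: uv block_norm_left block_norm_right block_vector_left block_vector_right of_real_def)
    show "premonogenic (a + b) (\<lambda>X.
        (u (norm (left_part X)) (norm (right_part X)) / norm (left_part X)) *\<^sub>R left_vector (left_part X)
        + (v (norm (left_part X)) (norm (right_part X)) / norm (right_part X))
          *\<^sub>R right_vector (right_part X))"
      by (rule premonogenic_cong[OF premonogenic_vector_form[OF f card]])
        (simp add: uv block_norm_left block_norm_right block_vector_left block_vector_right)
  qed
qed

end
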